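(* For every set $\mathbf{P}$ of predicates on functions there is an optimal problem complexity $C\{Pr(P(F),M)\}$: there is a Turing machine $M$ such that for every Turing machine $T$ there is a number $k$ such that for every predicate $P(F)\in\mathbf{P}$, $$C\{Pr(P(F),M)\}\le C\{Pr(P(F),T)\}+k .$$
   Context: $A$ is a fixed but arbitrary finite alphabet, $A^*$ is the set of finite words over $A$, and $l(p)$ is the length of a word $p$. Functions are (possibly partial) functions from $A^*$ to $A^*$. The Turing machines considered ($M$ and $T$) take as input a pair $(p,x)$ of words in $A^*$ (e.g., on two input tapes) and (possibly) give a word $T(p,x)$ as result. For a predicate $P(F)$, where $F$ is a functional variable, and a Turing machine $T$, the problem $Pr(P(F),T)$ is to find a word $p$ such that $T(p,x)=f(x)$ (as functions of $x$) for a function $f$ with $P(f)$ true; its problem complexity is $$C\{Pr(P(F),T)\}=\min\{\,l(p): T(p,x)=f(x)\text{ and }P(f)\text{ is true}\,\},$$ with the value $\infty$ when there is no such $p$ ($\infty$ is larger than any number and $\infty+k=\infty$).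
   Formalization: The alphabet A is required to have at least two letters; for an alphabet with one letter or none the claim fails, for example when P consists of all predicates "F = f". *)

theory Defs
  imports "HOL-Library.Extended_Nat"
begin

text \<open>
  The alphabet \<open>A\<close> is a finite type \<open>'a\<close>; words are lists, and possibly partial functions from
  words to words have type \<open>'a list \<Rightarrow> 'a list option\<close>.

  The machines are deterministic Turing machines with any number \<open>k \<ge> 3\<close> of two-way infinite tapes
  and any finite tape alphabet containing \<open>A\<close> and the blank. Tapes 0 and 1 are the input tapes
  and tape 2 is the output tape; all tapes can be read and written.
\<close>

datatype 'a symbol = Blank | Letter 'a | Aux nat

datatype move = MoveLeft | Stay | MoveRight

record 'a tm =
  tapes :: nat
  states :: "nat set"
  start :: nat
  symbols :: "'a symbol set"
  delta :: "nat \<Rightarrow> 'a symbol list \<Rightarrow> (nat \<times> ('a symbol \<times> move) list) option"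

text \<open>
  The transition function maps a state and the list of scanned symbols (one per tape) to the next
  state and one write-and-move action per tape; \<open>None\<close> means that the machine halts. Its values
  outside the finite domain described here are irrelevant, since they are never used in a run.
\<close>

definition turing_machine :: "'a tm \<Rightarrow> bool" where
  "turing_machine M \<longleftrightarrow>
     3 \<le> tapes M \<and>
     finite (states M) \<and> start M \<in> states M \<and>
     finite (symbols M) \<and> Blank \<in> symbols M \<and> range Letter \<subseteq> symbols M \<and>
     (\<forall>q ss q' as. q \<in> states M \<and> length ss = tapes M \<and> set ss \<subseteq> symbols M \<and>
        delta M q ss = Some (q', as) \<longrightarrow>
        q' \<in> states M \<and> length as = tapes M \<and> fst ` set as \<subseteq> symbols M)"

text \<open>A tape is its content together with the head position.\<close>

type_synonym 'a tape = "(int \<Rightarrow> 'a symbol) \<times> int"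

type_synonym 'a config = "nat \<times> 'a tape list"

fun scanned :: "'a tape \<Rightarrow> 'a symbol" where
  "scanned (t, h) = t h"

fun offset :: "move \<Rightarrow> int" where
  "offset MoveLeft = -1"
| "offset Stay = 0"
| "offset MoveRight = 1"

fun act :: "'a symbol \<times> move \<Rightarrow> 'a tape \<Rightarrow> 'a tape" where
  "act (s, d) (t, h) = (t(h := s), h + offset d)"

fun step :: "'a tm \<Rightarrow> 'a config \<Rightarrow> 'a config option" where
  "step M (q, ts) =
     (case delta M q (map scanned ts) of
        None \<Rightarrow> None
      | Some (q', as) \<Rightarrow> Some (q', map2 act as ts))"

definition word_tape :: "'a list \<Rightarrow> 'a tape" where
  "word_tape w = (\<lambda>i. if 0 \<le> i \<and> i < int (length w) then Letter (w ! nat i) else Blank, 0)"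

definition initial :: "'a tm \<Rightarrow> 'a list \<Rightarrow> 'a list \<Rightarrow> 'a config" where
  "initial M p x =
     (start M, word_tape p # word_tape x # replicate (tapes M - 2) (word_tape []))"

text \<open>
  The word on a tape is read from the head position to the right, up to (and excluding) the first
  cell that does not carry a letter of \<open>A\<close>.
\<close>

fun reads_word :: "'a tape \<Rightarrow> 'a list \<Rightarrow> bool" where
  "reads_word (t, h) w \<longleftrightarrow>
     (\<forall>i < length w. t (h + int i) = Letter (w ! i)) \<and> t (h + int (length w)) \<notin> range Letter"

definition yields :: "'a tm \<Rightarrow> 'a list \<Rightarrow> 'a list \<Rightarrow> 'a list \<Rightarrow> bool" where
  "yields M p x w \<longleftrightarrow>
     (\<exists>q ts. (\<lambda>c c'. step M c = Some c')\<^sup>*\<^sup>* (initial M p x) (q, ts) \<and>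
        step M (q, ts) = None \<and> reads_word (ts ! 2) w)"

text \<open>\<open>result M p x\<close> is \<open>M(p,x)\<close>; the following uniqueness lemma justifies the description operator.\<close>

definition result :: "'a tm \<Rightarrow> 'a list \<Rightarrow> 'a list \<Rightarrow> 'a list option" where
  "result M p x = (if \<exists>w. yields M p x w then Some (THE w. yields M p x w) else None)"

lemma reads_word_unique:
  assumes "reads_word tp v" and "reads_word tp w"
  shows "v = w"
proof -
  obtain t h where tp: "tp = (t, h)" by (cases tp)
  have "\<not> length v < length w" "\<not> length w < length v"
    using assms unfolding tp by auto
  then have "length v = length w" by simp
  then show ?thesis using assms unfolding tp by (auto intro!: nth_equalityI)
qed

lemma halting_unique:
  assumes "(\<lambda>c c'. step M c = Some c')\<^sup>*\<^sup>* c d" and "step M d = None"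
    and "(\<lambda>c c'. step M c = Some c')\<^sup>*\<^sup>* c e" and "step M e = None"
  shows "d = e"
  using assms(1,3)
proof (induction rule: converse_rtranclp_induct)
  case base
  then show ?case using assms(2) by (auto elim: converse_rtranclpE)
next
  case (step b c)
  have "b \<noteq> e" using step.hyps(1) assms(4) by auto
  then have "(\<lambda>c c'. step M c = Some c')\<^sup>*\<^sup>* c e"
    using step.prems step.hyps(1) by (auto elim: converse_rtranclpE)
  then show ?case by (rule step.IH)
qed

lemma yields_unique: "yields M p x v \<Longrightarrow> yields M p x w \<Longrightarrow> v = w"
  unfolding yields_def using halting_unique reads_word_unique by (metis prod.inject)

lemma result_eq_Some_iff: "result M p x = Some w \<longleftrightarrow> yields M p x w"
  unfolding result_def using yields_unique by (metis option.inject option.distinct(1) the_equality)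

text \<open>
  \<open>solves P T p\<close>: the word \<open>p\<close> is a solution of the problem \<open>Pr(P(F),T)\<close>. The equality of
  \<open>T(p,x)\<close> and \<open>f(x)\<close> includes that both are defined for the same \<open>x\<close>.
\<close>

definition solves :: "(('a list \<Rightarrow> 'a list option) \<Rightarrow> bool) \<Rightarrow> 'a tm \<Rightarrow> 'a list \<Rightarrow> bool" where
  "solves P T p \<longleftrightarrow> (\<exists>f. (\<forall>x. result T p x = f x) \<and> P f)"

text \<open>In \<^typ>\<open>enat\<close>, the infimum of a nonempty set is its minimum, and \<open>Inf {} = \<infinity>\<close>.\<close>

definition problem_complexity :: "(('a list \<Rightarrow> 'a list option) \<Rightarrow> bool) \<Rightarrow> 'a tm \<Rightarrow> enat" where
  "problem_complexity P T = Inf {enat (length p) | p. solves P T p}"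

lemma problem_complexity_infinite:
  "(\<nexists>p. solves P T p) \<Longrightarrow> problem_complexity P T = \<infinity>"
  unfolding problem_complexity_def by (simp add: Inf_enat_def)

lemma problem_complexity_attained:
  assumes "\<exists>p. solves P T p"
  shows "\<exists>p. solves P T p \<and> problem_complexity P T = enat (length p)"
proof -
  let ?S = "{enat (length p) | p. solves P T p}"
  have "?S \<noteq> {}" using assms by blast
  then have "Inf ?S \<in> ?S" unfolding Inf_enat_def by (auto intro: LeastI)
  then show ?thesis unfolding problem_complexity_def by blast
qed

text \<open>
  The alphabet must have at least two letters. Over a one-letter alphabet no optimal machine exists
  for the set of all predicates: there are only \<open>n + 1\<close> words of length at most \<open>n\<close>, so a machine
  \<open>M\<close> cannot match, up to additive constants, both a machine mapping \<open>(p,x)\<close> to the word of length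
  \<open>2 l(p)\<close> and one mapping it to the word of length \<open>2 l(p) + 1\<close>.
\<close>

end

theory Submission
  imports Defs "HOL-Library.Countable" "HOL-Library.More_List"
begin

text \<open>
  There is a universal machine \<open>M\<close>: every machine \<open>T\<close> has a code word \<open>c\<close> with \<open>M(cp, x) = T(p, x)\<close> for all
  \<open>p\<close> and \<open>x\<close>, so any solution \<open>p\<close> of a problem for \<open>T\<close> gives the solution \<open>cp\<close> for \<open>M\<close>, and \<open>k = l(c)\<close> works.

  Since \<open>T\<close> may have any number of tapes and any alphabet, its configuration is stored by \<open>M\<close> as one
  word, a sequence of stacks of bits: the two halves of each tape become stacks, on which every symbol
  is written as a bit vector of fixed length (all zero for the blank), and one more stack holds the
  state. One step of \<open>T\<close> then replaces the tops of all stacks at once, which a fixed machine can carry out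
  in a single pass over that word, guided by an edit script. The code \<open>c\<close> lists one script for each
  combination of state and scanned symbols; \<open>M\<close> applies the first script that fits until there is none.
\<close>

section \<open>Simulations between deterministic systems\<close>

text \<open>The words \<open>p\<close> and \<open>x\<close> cannot be recoded in the code of a
  configuration beforehand: \<open>p\<close> stands verbatim behind \<open>c\<close>, since recoding
  it could cost more than an additive constant. Therefore \<open>T\<close> is first turned into a
  machine whose tapes start blank, which takes its inputs letter by letter from two streams and
  emits its output letter by letter; the streams are the tapes of \<open>M\<close> itself. This also
  solves the problem of the initial configuration. \<open>M\<close> knows neither the number of
  tapes nor the length of the bit vectors, so it could not write one down. But when all tapes are
  blank, and the start state gets the zero vector just as the blank does, the implicit zeros below
  every stack make the empty word a correct initial configuration for every machine. The solutions
  concern partial functions, so divergence must be preserved as well as results. Each of the three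
  translations (to streams, to rewriting rules, to \<open>M\<close>) is therefore an equivalence of
  halting runs with equal outputs.\<close>

abbreviation steps :: "('c \<Rightarrow> 'c option) \<Rightarrow> 'c \<Rightarrow> 'c \<Rightarrow> bool" where
  "steps f \<equiv> (\<lambda>c d. f c = Some d)\<^sup>*\<^sup>*"

abbreviation steps1 :: "('c \<Rightarrow> 'c option) \<Rightarrow> 'c \<Rightarrow> 'c \<Rightarrow> bool" where
  "steps1 f \<equiv> (\<lambda>c d. f c = Some d)\<^sup>+\<^sup>+"

definition halts_at :: "('c \<Rightarrow> 'c option) \<Rightarrow> 'c \<Rightarrow> 'c \<Rightarrow> bool" where
  "halts_at f c d \<longleftrightarrow> steps f c d \<and> f d = None"

lemma steps_step: "f c = Some d \<Longrightarrow> steps f d e \<Longrightarrow> steps f c e"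
  by (rule converse_rtranclp_into_rtranclp)

lemma halts_at_step: "f c = Some d \<Longrightarrow> halts_at f c e \<longleftrightarrow> halts_at f d e"
  unfolding halts_at_def by (auto elim: converse_rtranclpE intro: steps_step)

lemma halts_at_steps: "steps f c d \<Longrightarrow> halts_at f c e \<longleftrightarrow> halts_at f d e"
  by (induction rule: converse_rtranclp_induct) (auto simp: halts_at_step)

lemma halts_at_unique: "halts_at f c d \<Longrightarrow> halts_at f c e \<Longrightarrow> d = e"
  using halts_at_steps[of f c d e] unfolding halts_at_def by (auto elim: converse_rtranclpE)

text \<open>By determinism every finite run from \<open>c\<close> is an initial segment of the
  halting one.\<close>

lemma relpowp_before_halt:
  assumes "((\<lambda>c d. f c = Some d) ^^ m) c c'" "((\<lambda>c d. f c = Some d) ^^ n) c d" "f d = None"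
  shows "m \<le> n \<and> ((\<lambda>c d. f c = Some d) ^^ (n - m)) c' d"
  using assms
proof (induction m arbitrary: c n)
  case (Suc m)
  obtain c1 where c1: "f c = Some c1" "((\<lambda>c d. f c = Some d) ^^ m) c1 c'"
    using relpowp_Suc_D2[OF Suc.prems(1)] by (elim exE conjE)
  have "n \<noteq> 0"
  proof
    assume "n = 0"
    then have "c = d" using Suc.prems(2) by simp
    then show False using c1(1) Suc.prems(3) by simp
  qed
  then obtain n' where n': "n = Suc n'" by (rule not0_implies_Suc[THEN exE])
  obtain c2 where "f c = Some c2" "((\<lambda>c d. f c = Some d) ^^ n') c2 d"
    using relpowp_Suc_D2[OF Suc.prems(2)[unfolded n']] by (elim exE conjE)
  then have "((\<lambda>c d. f c = Some d) ^^ n') c1 d"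
    using c1(1) by (simp only: option.inject)
  from Suc.IH[OF c1(2) this Suc.prems(3)] n' show ?case by (simp only: diff_Suc_Suc Suc_le_mono)
qed simp

text \<open>A step of \<open>f\<close> must be answered by at least one step of \<open>g\<close>:
  otherwise a diverging \<open>f\<close> could be matched with a halting \<open>g\<close>. The
  nonempty answer shortens what remains of the halting run of \<open>g\<close>, and the converse
  direction is an induction on that length.\<close>

lemma simulation:
  assumes rel: "rel c c'"
    and step: "\<And>c c' d. rel c c' \<Longrightarrow> f c = Some d \<Longrightarrow> \<exists>d'. steps1 g c' d' \<and> rel d d'"
    and halt: "\<And>c c'. rel c c' \<Longrightarrow> f c = None \<Longrightarrow>
      \<exists>d'. halts_at g c' d' \<and> (\<forall>w. out1 c w \<longleftrightarrow> out2 d' w)"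
  shows "(\<exists>d. halts_at f c d \<and> out1 d w) \<longleftrightarrow> (\<exists>d'. halts_at g c' d' \<and> out2 d' w)"
proof
  assume "\<exists>d. halts_at f c d \<and> out1 d w"
  then obtain d where "steps f c d" "f d = None" "out1 d w" by (auto simp: halts_at_def)
  then show "\<exists>d'. halts_at g c' d' \<and> out2 d' w"
    using rel
  proof (induction arbitrary: c' rule: converse_rtranclp_induct)
    case base
    then show ?case using halt by blast
  next
    case (step c e)
    obtain e' where "steps1 g c' e'" "rel e e'"
      using assms(2)[OF step.prems(3) step.hyps(1)] by blast
    then show ?case
      using step.IH[OF step.prems(1,2), of e'] halts_at_steps[of g c' e'] tranclp_into_rtranclp by metis
  qed
next
  assume "\<exists>d'. halts_at g c' d' \<and> out2 d' w"
  then obtain d' n where d': "((\<lambda>c d. g c = Some d) ^^ n) c' d'" "g d' = None" "out2 d' w"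
    by (auto simp: halts_at_def rtranclp_power)
  from this(1) rel show "\<exists>d. halts_at f c d \<and> out1 d w"
  proof (induction n arbitrary: c c' rule: less_induct)
    case (less n)
    show ?case
    proof (cases "f c")
      case None
      then obtain e' where e': "halts_at g c' e'" "\<forall>w. out1 c w \<longleftrightarrow> out2 e' w"
        using halt less.prems(2) by blast
      moreover have "halts_at g c' d'"
        using less.prems(1) d'(2) by (auto simp: halts_at_def rtranclp_power)
      ultimately have "out1 c w" using d'(3) halts_at_unique by metis
      then show ?thesis using None by (auto simp: halts_at_def)
    next
      case (Some e)
      then obtain e' where e': "steps1 g c' e'" "rel e e'" using step less.prems(2) by blast
      then obtain m where "m > 0" "((\<lambda>c d. g c = Some d) ^^ m) c' e'" by (auto simp: tranclp_power)
      with relpowp_before_halt[OF _ less.prems(1) d'(2)]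
      have "((\<lambda>c d. g c = Some d) ^^ (n - m)) e' d'" "n - m < n" by force+
      with less.IH e'(2) show ?thesis using halts_at_step[of f c e] Some by metis
    qed
  qed
qed

lemma yields_iff_halts_at:
  "yields M p x w \<longleftrightarrow> (\<exists>c. halts_at (step M) (initial M p x) c \<and> reads_word (snd c ! 2) w)"
  unfolding yields_def halts_at_def by auto

section \<open>Tapes as pairs of lists\<close>

definition hd_or :: "'b \<Rightarrow> 'b list \<Rightarrow> 'b" where
  "hd_or b xs = (case xs of [] \<Rightarrow> b | x # _ \<Rightarrow> x)"

lemma hd_or_simps [simp]: "hd_or b [] = b" "hd_or b (x # xs) = x"
  by (simp_all add: hd_or_def)

lemma hd_or_eq: "hd_or b xs = nth_default b xs 0"
  by (cases xs) auto

lemma nth_default_tl [simp]: "nth_default b (tl xs) n = nth_default b xs (Suc n)"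
  by (cases xs) auto

text \<open>Both halves are listed from the head outwards, the scanned cell being the first of
  \<open>r\<close>. Trailing blanks are free, so a tape has many representations.\<close>

fun tape_rep :: "'a tape \<Rightarrow> 'a symbol list \<times> 'a symbol list \<Rightarrow> bool" where
  "tape_rep (t, h) (l, r) \<longleftrightarrow>
     (\<forall>n. t (h + int n) = nth_default Blank r n) \<and> (\<forall>n. t (h - 1 - int n) = nth_default Blank l n)"

lemma tape_rep_scanned: "tape_rep t z \<Longrightarrow> scanned t = hd_or Blank (snd z)"
  by (cases t; cases z) (auto simp: hd_or_eq dest: spec[of _ 0])

lemma tape_rep_cong:
  assumes "tape_rep t (l, r)" "\<And>n. nth_default Blank l' n = nth_default Blank l n"
    "\<And>n. nth_default Blank r' n = nth_default Blank r n"
  shows "tape_rep t (l', r')"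
  using assms by (cases t) auto

text \<open>The words that replace the cell \<open>l\<close> left of the head and the scanned cell in the two halves of a tape.\<close>

fun push :: "'a symbol \<times> move \<Rightarrow> 'a symbol \<Rightarrow> 'a symbol list \<times> 'a symbol list" where
  "push (s, MoveLeft) l = ([], [l, s])"
| "push (s, Stay) l = ([l], [s])"
| "push (s, MoveRight) l = ([s, l], [])"

text \<open>All three moves get the same form: one cell is popped from each half, and a word is
  pushed that depends only on the action and on the popped left cell. This is what an edit script
  can do to a stack.\<close>

lemma tape_rep_act:
  assumes "tape_rep t (l, r)"
  shows "tape_rep (act a t) (fst (push a (hd_or Blank l)) @ tl l, snd (push a (hd_or Blank l)) @ tl r)"
proof -
  obtain f h where t: "t = (f, h)" by (cases t)
  obtain s d where a: "a = (s, d)" by (cases a)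
  have r: "f (h + int n) = nth_default Blank r n" and l: "f (h - 1 - int n) = nth_default Blank l n" for n
    using assms by (auto simp: t)
  have r1: "f (h + 1 + int n) = nth_default Blank r (Suc n)" for n
    using r[of "Suc n"] by (simp add: algebra_simps)
  have l1: "f (h - 2 - int n) = nth_default Blank l (Suc n)" for n
    using l[of "Suc n"] by (simp add: algebra_simps)
  show ?thesis
  proof (cases d)
    case MoveLeft
    have "(f(h := s)) (h - 1 + int n) = nth_default Blank (hd_or Blank l # s # tl r) n" for n
    proof (cases n)
      case 0
      then show ?thesis using l[of 0] by (simp add: hd_or_eq)
    next
      case (Suc m)
      then show ?thesis using r[of m] by (cases m) (auto simp: algebra_simps)
    qed
    then show ?thesis using l1 by (simp add: t a MoveLeft algebra_simps)
  next
    case Stay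
    have "(f(h := s)) (h + int n) = nth_default Blank (s # tl r) n" for n
      using r[of n] by (cases n) auto
    moreover have "(f(h := s)) (h - 1 - int n) = nth_default Blank (hd_or Blank l # tl l) n" for n
      using l[of n] by (cases n) (auto simp: hd_or_eq)
    ultimately show ?thesis by (simp add: t a Stay)
  next
    case MoveRight
    have "(f(h := s)) (h - int n) = nth_default Blank (s # hd_or Blank l # tl l) n" for n
    proof (cases n)
      case (Suc m)
      then show ?thesis using l[of m] by (cases m) (auto simp: hd_or_eq algebra_simps)
    qed simp
    then show ?thesis using r1 by (simp add: t a MoveRight algebra_simps)
  qed
qed

text \<open>A list stands for its extension by blanks; \<open>bcons\<close> keeps it free of a trailing blank.\<close>

definition bcons :: "'a symbol \<Rightarrow> 'a symbol list \<Rightarrow> 'a symbol list" where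
  "bcons s r = (if s = Blank \<and> r = [] then [] else s # r)"

lemma nth_default_bcons [simp]: "nth_default Blank (bcons s r) n = nth_default Blank (s # r) n"
  by (cases n) (auto simp: bcons_def)

lemma bcons_simps [simp]:
  "s \<noteq> Blank \<Longrightarrow> bcons s r = s # r"  "bcons Blank [] = []" "tl (bcons s r) = r"
  "hd_or Blank (bcons s r) = s" "r \<noteq> [] \<Longrightarrow> bcons s r = s # r"
  by (auto simp: bcons_def)

text \<open>The variant for concrete runs, evaluated by simplification. The test in the
  \<open>Stay\<close> case makes rewriting the scanned symbol the identity on every pair, even one
  with trailing blanks, so that untouched tapes can be variables in the lemmas about single
  phases.\<close>

fun zact :: "'a symbol \<times> move \<Rightarrow> 'a symbol list \<times> 'a symbol list \<Rightarrow> 'a symbol list \<times> 'a symbol list" where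
  "zact (s, MoveLeft) (l, r) = (tl l, bcons (hd_or Blank l) (bcons s (tl r)))"
| "zact (s, Stay) (l, r) = (l, if s = hd_or Blank r then r else bcons s (tl r))"
| "zact (s, MoveRight) (l, r) = (bcons s l, tl r)"

definition ztop :: "'a symbol list \<times> 'a symbol list \<Rightarrow> 'a symbol" where
  "ztop z = hd_or Blank (snd z)"

lemma ztop_Pair [simp]: "ztop (l, r) = hd_or Blank r"
  by (simp add: ztop_def)

lemma zact_stay [simp]: "zact (ztop z, Stay) z = z"
  by (cases z) simp

lemma tape_rep_zact:
  assumes "tape_rep t z" shows "tape_rep (act a t) (zact a z)"
proof -
  obtain l r s d where [simp]: "z = (l, r)" "a = (s, d)" by (cases z, cases a)
  let ?p = "push a (hd_or Blank l)"
  have rep: "tape_rep (act a t) (fst ?p @ tl l, snd ?p @ tl r)"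
    using assms by (simp add: tape_rep_act del: tape_rep.simps)
  have "nth_default Blank (fst (zact a z)) n = nth_default Blank (fst ?p @ tl l) n"
    "nth_default Blank (snd (zact a z)) n = nth_default Blank (snd ?p @ tl r) n" for n
    by (cases d; auto simp: nth_default_Cons hd_or_eq split: nat.splits)+
  then show ?thesis
    using tape_rep_cong[OF rep, of "fst (zact a z)" "snd (zact a z)"] by simp
qed

fun zstep :: "'a tm \<Rightarrow> nat \<times> ('a symbol list \<times> 'a symbol list) list \<Rightarrow>
    (nat \<times> ('a symbol list \<times> 'a symbol list) list) option" where
  "zstep M (q, zs) =
     (case delta M q (map ztop zs) of
        None \<Rightarrow> None
      | Some (q', as) \<Rightarrow> Some (q', map2 zact as zs))"

definition zinitial :: "'a tm \<Rightarrow> 'a list \<Rightarrow> 'a list \<Rightarrow> nat \<times> ('a symbol list \<times> 'a symbol list) list" where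
  "zinitial M p x =
     (start M, ([], map Letter p) # ([], map Letter x) # replicate (tapes M - 2) ([], []))"

lemma tape_rep_word_tape: "tape_rep (word_tape w) ([], map Letter w)"
  by (auto simp: word_tape_def nth_default_def)

lemma tape_rep_map_scanned: "list_all2 tape_rep ts zs \<Longrightarrow> map scanned ts = map ztop zs"
  by (induction rule: list_all2_induct) (auto simp: tape_rep_scanned ztop_def simp del: tape_rep.simps scanned.simps)

lemma tape_rep_map2: "list_all2 tape_rep ts zs \<Longrightarrow> list_all2 tape_rep (map2 act as ts) (map2 zact as zs)"
proof (induction ts zs arbitrary: as rule: list_all2_induct)
  case (Cons t ts z zs)
  then show ?case by (cases as) (auto simp: tape_rep_zact)
qed simp

lemma tape_rep_reads_word:
  assumes "tape_rep t (l, map Letter v)" shows "reads_word t w \<longleftrightarrow> w = v"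
proof -
  have "reads_word t v"
    using assms by (cases t) (auto simp: nth_default_def)
  then show ?thesis using reads_word_unique by blast
qed

definition crep :: "'a config \<Rightarrow> nat \<times> ('a symbol list \<times> 'a symbol list) list \<Rightarrow> bool" where
  "crep c d \<longleftrightarrow> fst c = fst d \<and> list_all2 tape_rep (snd c) (snd d)"

text \<open>Lists and tapes proceed step for step, so runs and halting of the universal machine can
  be computed on lists.\<close>

lemma crep_step:
  assumes "crep c d"
  shows "zstep M d = Some d' \<Longrightarrow> \<exists>c'. step M c = Some c' \<and> crep c' d'"
    and "zstep M d = None \<Longrightarrow> step M c = None"
proof -
  obtain q ts zs where [simp]: "c = (q, ts)" "d = (q, zs)"
    using assms by (cases c, cases d) (auto simp: crep_def)
  have rep: "list_all2 tape_rep ts zs" using assms by (simp add: crep_def)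
  show "zstep M d = Some d' \<Longrightarrow> \<exists>c'. step M c = Some c' \<and> crep c' d'"
    "zstep M d = None \<Longrightarrow> step M c = None"
    by (auto simp: tape_rep_map_scanned[OF rep] crep_def tape_rep_map2[OF rep]
        split: option.splits)
qed

lemma crep_steps: "steps (zstep M) d d' \<Longrightarrow> crep c d \<Longrightarrow> \<exists>c'. steps (step M) c c' \<and> crep c' d'"
proof (induction arbitrary: c rule: converse_rtranclp_induct)
  case (step d e)
  then show ?case using crep_step(1)[of c d M e] steps_step by metis
qed blast

lemma crep_steps1:
  assumes "steps1 (zstep M) d d'" "crep c d" shows "\<exists>c'. steps1 (step M) c c' \<and> crep c' d'"
proof -
  obtain e where e: "zstep M d = Some e" "steps (zstep M) e d'"
    using tranclpD[OF assms(1)] by (elim exE conjE)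
  obtain c1 where c1: "step M c = Some c1" "crep c1 e"
    using crep_step(1)[OF assms(2) e(1)] by (elim exE conjE)
  obtain c' where c': "steps (step M) c1 c'" "crep c' d'"
    using crep_steps[OF e(2) c1(2)] by (elim exE conjE)
  have "steps1 (step M) c c'"
    by (rule rtranclp_into_tranclp2[OF _ c'(1)]) (rule c1(1))
  then show ?thesis using c'(2) by (intro exI conjI)
qed

lemma crep_halts_at:
  assumes "halts_at (zstep M) d d'" "crep c d" shows "\<exists>c'. halts_at (step M) c c' \<and> crep c' d'"
proof -
  obtain c' where "steps (step M) c c'" "crep c' d'"
    using crep_steps[of M d d' c] assms unfolding halts_at_def by blast
  moreover from this have "step M c' = None"
    using crep_step(2)[of c' d' M] assms(1) by (simp add: halts_at_def)
  ultimately show ?thesis unfolding halts_at_def by (intro exI conjI)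
qed

lemma crep_initial: "crep (initial M p x) (zinitial M p x)"
proof -
  have "list_all2 tape_rep (replicate n (word_tape [])) (replicate n ([], []))" for n
    using tape_rep_word_tape[of "[]"] by (auto simp: list_all2_conv_all_nth simp del: tape_rep.simps)
  then show ?thesis
    by (simp add: crep_def initial_def zinitial_def tape_rep_word_tape del: tape_rep.simps)
qed

section \<open>Rewriting machines\<close>

text \<open>
  A rewriting machine works on a word over \<^typ>\<open>bool option\<close>, read as a sequence of stacks of bits with
  \<^const>\<open>None\<close> closing each stack. An edit script runs through this word once, so that a rule can
  rewrite the tops of all stacks simultaneously. Below the bottom of a stack there are
  infinitely many \<^const>\<open>False\<close>, and infinitely many empty stacks follow the last one.
\<close>

datatype 'a edit = Match bool | Emit bool | Next | Look "'a option" "'a option"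

definition head :: "'b list \<Rightarrow> 'b option" where
  "head xs = (case xs of [] \<Rightarrow> None | x # _ \<Rightarrow> Some x)"

lemma head_simps [simp]: "head [] = None" "head (x # xs) = Some x"
  by (simp_all add: head_def)

text \<open>The result of an edit command consists of the emitted word and the remaining input.\<close>

fun edit1 :: "'a option \<Rightarrow> 'a option \<Rightarrow> 'a edit \<Rightarrow> bool option list \<Rightarrow>
    (bool option list \<times> bool option list) option" where
  "edit1 u v (Match b) w =
     (if head w = Some (Some b) then Some ([], tl w)
      else if b \<or> head w = Some (Some True) then None else Some ([], w))"
| "edit1 u v (Emit b) w = Some ([Some b], w)"
| "edit1 u v Next w =
     Some (takeWhile (\<lambda>z. z \<noteq> None) w @ [None], tl (dropWhile (\<lambda>z. z \<noteq> None) w))"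
| "edit1 u v (Look u' v') w = (if u' = u \<and> v' = v then Some ([], w) else None)"

text \<open>A script produces the entire new word: input that it leaves unread is dropped.\<close>

fun exec :: "'a option \<Rightarrow> 'a option \<Rightarrow> 'a edit list \<Rightarrow> bool option list \<Rightarrow> bool option list option" where
  "exec u v [] w = Some []"
| "exec u v (e # es) w =
     (case edit1 u v e w of None \<Rightarrow> None | Some (y, w') \<Rightarrow> map_option ((@) y) (exec u v es w'))"

text \<open>
  The flags of a rule tell whether it consumes the first letter of either input word, and its last
  component is a letter to be appended to the output word, which is the last component of a configuration.
\<close>

type_synonym 'a rule = "'a edit list \<times> bool \<times> bool \<times> 'a option"
type_synonym 'a rconfig = "bool option list \<times> 'a list \<times> 'a list \<times> 'a list"

definition consume :: "bool \<Rightarrow> 'b list \<Rightarrow> 'b list" where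
  "consume b xs = (if b then tl xs else xs)"

fun rstep :: "'a rule list \<Rightarrow> 'a rconfig \<Rightarrow> 'a rconfig option" where
  "rstep [] C = None"
| "rstep ((es, a, b, d) # rs) (w, p, x, y) =
     (case exec (head p) (head x) es w of
        Some w' \<Rightarrow> Some (w', consume a p, consume b x, y @ (case d of None \<Rightarrow> [] | Some l \<Rightarrow> [l]))
      | None \<Rightarrow> rstep rs (w, p, x, y))"

section \<open>The universal machine\<close>

datatype 'a instr = Edit "'a edit" | End bool bool "'a option" | Stop

instance edit :: (countable) countable by countable_datatype
instance instr :: (countable) countable by countable_datatype

instance edit :: (finite) finite
proof
  have "(UNIV :: 'a edit set) \<subseteq> range Match \<union> range Emit \<union> {Next} \<union> range (\<lambda>(u, v). Look u v)"
    by (auto simp: image_iff) (metis edit.exhaust)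
  then show "finite (UNIV :: 'a edit set)" by (rule finite_subset) auto
qed

instance instr :: (finite) finite
proof
  have "(UNIV :: 'a instr set) \<subseteq> range Edit \<union> range (\<lambda>(a, b, d). End a b d) \<union> {Stop}"
    by (auto simp: image_iff) (metis instr.exhaust)
  then show "finite (UNIV :: 'a instr set)" by (rule finite_subset) auto
qed

section \<open>The transition table of the universal machine\<close>

datatype ustate = Load nat | RewindProg | Run | EraseMain | CopyBack
  | RewindMain | EraseScratch | SkipRule | RewindOut | Halt

instance ustate :: countable by countable_datatype

definition isym :: "'a::finite instr \<Rightarrow> 'a symbol" where
  "isym i = Aux (to_nat i)"

text \<open>The numbers used by \<open>isym\<close> and \<open>msym\<close> may coincide; the former
  occur only on tape 3, the latter only on tapes 4 and 5.\<close>

definition msym :: "bool option \<Rightarrow> 'a symbol" where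
  "msym z = Aux (to_nat z)"

definition osym :: "'a option \<Rightarrow> 'a symbol" where
  "osym u = (case u of None \<Rightarrow> Blank | Some l \<Rightarrow> Letter l)"

lemma isym_simps [simp]: "isym i = isym j \<longleftrightarrow> i = j" "isym i \<noteq> Blank" "Blank \<noteq> isym i"
  by (simp_all add: isym_def)

lemma msym_simps [simp]: "msym i = msym j \<longleftrightarrow> i = j" "msym i \<noteq> Blank" "Blank \<noteq> msym i"
  by (simp_all add: msym_def)

lemma osym_simps [simp]: "osym None = Blank" "osym (Some l) = Letter l" "osym u = osym v \<longleftrightarrow> u = v"
  by (auto simp: osym_def split: option.splits)

lemma hd_or_Letter [simp]: "hd_or Blank (map Letter p) = osym (head p)"
  by (cases p) auto

definition stay :: "'a symbol list \<Rightarrow> ('a symbol \<times> move) list" where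
  "stay ss = map (\<lambda>s. (s, Stay)) ss"

text \<open>The old word stays on tape 4 until \<open>End\<close> is reached, so that a failing
  script can be undone by rewinding tape 4 and erasing tape 5. During \<open>Next\<close> the
  program head stands still while symbols are copied, which repeats the instruction up to the
  separator; a blank on tape 4 acts as the separator of an implicit empty stack. \<open>End\<close>
  walks to the right end first because the old word is erased leftwards from there.\<close>

fun urun :: "'a::finite instr \<Rightarrow> 'a symbol list \<Rightarrow> (ustate \<times> ('a symbol \<times> move) list) option" where
  "urun (Edit e) ss =
     (let ok = (stay ss)[3 := (ss ! 3, MoveRight)];
          fail = (RewindMain, (stay ss)[4 := (ss ! 4, MoveLeft), 5 := (Blank, MoveLeft)])
      in case e of
        Match b \<Rightarrow>
          if ss ! 4 = msym (Some b) then Some (Run, ok[4 := (ss ! 4, MoveRight)])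
          else if b \<or> ss ! 4 = msym (Some True) then Some fail
          else Some (Run, ok)
      | Emit b \<Rightarrow> Some (Run, ok[5 := (msym (Some b), MoveRight)])
      | Next \<Rightarrow>
          if ss ! 4 = Blank then Some (Run, ok[5 := (msym None, MoveRight)])
          else if ss ! 4 = msym None then Some (Run, ok[4 := (ss ! 4, MoveRight), 5 := (msym None, MoveRight)])
          else Some (Run, (stay ss)[4 := (ss ! 4, MoveRight), 5 := (ss ! 4, MoveRight)])
      | Look u v \<Rightarrow> Some (if ss ! 0 = osym u \<and> ss ! 1 = osym v then (Run, ok) else fail))"
| "urun (End a b d) ss =
     (if ss ! 4 \<noteq> Blank then Some (Run, (stay ss)[4 := (ss ! 4, MoveRight)])
      else Some (EraseMain,
        [(ss ! 0, if a then MoveRight else Stay), (ss ! 1, if b then MoveRight else Stay),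
         (case d of None \<Rightarrow> (ss ! 2, Stay) | Some l \<Rightarrow> (Letter l, MoveRight)),
         (ss ! 3, MoveLeft), (Blank, MoveLeft), (Blank, MoveLeft)]))"
| "urun Stop ss = Some (RewindOut, (stay ss)[2 := (ss ! 2, MoveLeft)])"

text \<open>The counter of \<open>Load\<close> is part of the state, and its bound \<open>K\<close>
  keeps the states finite. \<open>CopyBack\<close> writes leftwards from the blank before the erased
  word: the word drifts along tape 4, but only positions relative to the head matter. After a failed
  rule the program is not rewound but continued behind the next \<open>End\<close>; it is rewound
  only after a rule has been applied.\<close>

fun udelta :: "'a::finite \<Rightarrow> 'a \<Rightarrow> nat \<Rightarrow> ustate \<Rightarrow> 'a symbol list \<Rightarrow> (ustate \<times> ('a symbol \<times> move) list) option" where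
  "udelta a b K (Load j) ss =
     (if ss ! 0 = Letter a \<and> j < K then Some (Load (Suc j), (stay ss)[0 := (ss ! 0, MoveRight)])
      else if ss ! 0 = Letter b then
        (if j = to_nat (Stop :: 'a instr)
         then Some (RewindProg, (stay ss)[0 := (ss ! 0, MoveRight), 3 := (Aux j, MoveLeft)])
         else Some (Load 0, (stay ss)[0 := (ss ! 0, MoveRight), 3 := (Aux j, MoveRight)]))
      else None)"
| "udelta a b K RewindProg ss =
     Some (if ss ! 3 = Blank then (Run, (stay ss)[3 := (ss ! 3, MoveRight)])
           else (RewindProg, (stay ss)[3 := (ss ! 3, MoveLeft)]))"
| "udelta a b K Run ss = (case ss ! 3 of Aux n \<Rightarrow> urun (from_nat n) ss | _ \<Rightarrow> None)"
| "udelta a b K EraseMain ss =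
     Some (if ss ! 4 = Blank then (CopyBack, stay ss)
           else (EraseMain, (stay ss)[4 := (Blank, MoveLeft)]))"
| "udelta a b K CopyBack ss =
     Some (if ss ! 5 = Blank then (RewindProg, (stay ss)[4 := (ss ! 4, MoveRight)])
           else (CopyBack, (stay ss)[4 := (ss ! 5, MoveLeft), 5 := (Blank, MoveLeft)]))"
| "udelta a b K RewindMain ss =
     Some (if ss ! 4 = Blank then (EraseScratch, (stay ss)[4 := (ss ! 4, MoveRight)])
           else (RewindMain, (stay ss)[4 := (ss ! 4, MoveLeft)]))"
| "udelta a b K EraseScratch ss =
     Some (if ss ! 5 = Blank then (SkipRule, stay ss)
           else (EraseScratch, (stay ss)[5 := (Blank, MoveLeft)]))"
| "udelta a b K SkipRule ss =
     Some (if \<exists>u v d. ss ! 3 = isym (End u v d) then Run else SkipRule, (stay ss)[3 := (ss ! 3, MoveRight)])"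
| "udelta a b K RewindOut ss =
     Some (if ss ! 2 = Blank then (Halt, (stay ss)[2 := (ss ! 2, MoveRight)])
           else (RewindOut, (stay ss)[2 := (ss ! 2, MoveLeft)]))"
| "udelta a b K Halt ss = None"

definition ustates :: "nat \<Rightarrow> ustate set" where
  "ustates K = Load ` {..K} \<union> {RewindProg, Run, EraseMain, CopyBack, RewindMain, EraseScratch, SkipRule, RewindOut, Halt}"

text \<open>
  Tapes 0 to 2 hold the two inputs and the output, tape 3 the program, tape 4 the word of the
  rewriting machine, and tape 5 collects the rewritten word. The number \<open>K\<close> bounds the codes of the
  symbols on tapes 3 to 5.
\<close>

definition utm :: "'a::finite \<Rightarrow> 'a \<Rightarrow> nat \<Rightarrow> 'a tm" where
  "utm a b K = \<lparr>tapes = 6, states = to_nat ` ustates K, start = to_nat (Load 0),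
     symbols = {Blank} \<union> range Letter \<union> Aux ` {..K},
     delta = (\<lambda>q ss. map_option (apfst to_nat) (udelta a b K (from_nat q) ss))\<rparr>"

section \<open>Finiteness of states and symbols, validity of all transitions\<close>

definition code_bound :: "nat \<Rightarrow> 'a::finite itself \<Rightarrow> bool" where
  "code_bound K _ \<longleftrightarrow> range (to_nat :: 'a instr \<Rightarrow> nat) \<union> range (to_nat :: bool option \<Rightarrow> nat) \<subseteq> {..K}"

lemma ex_code_bound: "\<exists>K. code_bound K TYPE('a::finite)"
proof -
  let ?N = "range (to_nat :: 'a instr \<Rightarrow> nat) \<union> range (to_nat :: bool option \<Rightarrow> nat)"
  have "finite ?N" by simp
  then have "?N \<subseteq> {..Max ?N}" by (intro subsetI) (simp only: atMost_iff Max_ge)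
  then show ?thesis unfolding code_bound_def by blast
qed

lemma length_stay [simp]: "length (stay ss) = length ss"
  by (simp add: stay_def)

definition valid_acts :: "nat \<Rightarrow> 'a symbol set \<Rightarrow> ('a symbol \<times> move) list \<Rightarrow> bool" where
  "valid_acts n S as \<longleftrightarrow> length as = n \<and> fst ` set as \<subseteq> S"

lemma valid_acts_stay: "length ss = n \<Longrightarrow> set ss \<subseteq> S \<Longrightarrow> valid_acts n S (stay ss)"
  by (auto simp: valid_acts_def stay_def)

lemma valid_acts_update: "valid_acts n S as \<Longrightarrow> s \<in> S \<Longrightarrow> valid_acts n S (as[i := (s, d)])"
  using set_update_subset_insert[of as i "(s, d)"] by (fastforce simp: valid_acts_def)

lemma urun_valid:
  assumes "urun i ss = Some (q, as)" "length ss = 6" "set ss \<subseteq> S"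
    "Blank \<in> S" "range Letter \<subseteq> S" "range msym \<subseteq> S"
  shows "q \<in> {Run, RewindMain, EraseMain, RewindOut} \<and> valid_acts 6 S as"
proof -
  have nth: "ss ! n \<in> S" if "n < 6" for n using assms(2,3) that nth_mem by (metis subsetD)
  have msym: "msym z \<in> S" and Letter: "Letter l \<in> S" for z l using assms(5,6) by auto
  note valid = valid_acts_update valid_acts_stay[OF assms(2,3)] nth msym Letter assms(4)
  show ?thesis
  proof (cases i)
    case (Edit e)
    then show ?thesis
      using assms(1) by (cases e) (auto simp: Let_def valid split: if_splits)
  next
    case (End a b d)
    have "fst (case d of None \<Rightarrow> (ss ! 2, Stay) | Some l \<Rightarrow> (Letter l, MoveRight)) \<in> S"
      by (cases d) (auto simp: valid)
    then show ?thesis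
      using assms(1) End by (auto simp: valid valid_acts_def[of 6 S "[_, _, _, _, _, _]"] split: if_splits)
  next
    case Stop
    then show ?thesis using assms(1) by (auto simp: valid)
  qed
qed

lemma udelta_valid:
  assumes "udelta a b K q ss = Some (q', as)" "q \<in> ustates K" "length ss = 6" "set ss \<subseteq> S"
    "Blank \<in> S" "range Letter \<subseteq> S" "range msym \<subseteq> S" "Aux ` {..K} \<subseteq> S"
  shows "q' \<in> ustates K \<and> valid_acts 6 S as"
proof -
  have nth: "ss ! n \<in> S" if "n < 6" for n using assms(3,4) that nth_mem by (metis subsetD)
  have Letter: "Letter l \<in> S" for l using assms(6) by auto
  have Aux: "Aux j \<in> S" if "j \<le> K" for j using assms(8) that by auto
  note valid = valid_acts_update valid_acts_stay[OF assms(3,4)] nth Aux Letter assms(5)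
  have skip: "valid_acts 6 S ((stay ss)[3 := (ss ! 3, MoveRight)])"
    by (simp add: valid)
  show ?thesis
  proof (cases q)
    case Run
    then show ?thesis
      using assms(1) urun_valid[OF _ assms(3-7), of _ q' as]
      by (auto simp: ustates_def split: symbol.splits)
  next
    case SkipRule
    then show ?thesis
      using assms(1) skip by (auto simp: ustates_def split: if_splits)
  qed (use assms(1,2) in \<open>auto simp: ustates_def valid split: if_splits\<close>)
qed

lemma turing_machine_utm:
  assumes "code_bound K TYPE('a::finite)" shows "turing_machine (utm a (b::'a) K)"
proof -
  let ?S = "symbols (utm a b K)"
  have S: "Blank \<in> ?S" "range Letter \<subseteq> ?S" "range msym \<subseteq> ?S" "Aux ` {..K} \<subseteq> ?S"
    using assms by (auto simp: utm_def code_bound_def msym_def)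
  have utm: "finite (states (utm a b K))" "finite ?S" "start (utm a b K) \<in> states (utm a b K)"
    "tapes (utm a b K) = 6"
    by (auto simp: utm_def ustates_def)
  have "q' \<in> states (utm a b K) \<and> length as = tapes (utm a b K) \<and> fst ` set as \<subseteq> ?S"
    if h: "q \<in> states (utm a b K) \<and> length ss = tapes (utm a b K) \<and> set ss \<subseteq> ?S \<and>
      delta (utm a b K) q ss = Some (q', as)" for q ss q' as
  proof -
    obtain u where u: "q = to_nat u" "u \<in> ustates K"
      using h by (auto simp: utm_def)
    moreover obtain u' where "udelta a b K u ss = Some (u', as)" "q' = to_nat u'"
      using h u by (auto simp: utm_def)
    moreover have "length ss = 6" "set ss \<subseteq> ?S" using h utm by auto
    ultimately have "u' \<in> ustates K" "valid_acts 6 ?S as" using udelta_valid S by blast+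
    then show ?thesis using \<open>q' = _\<close> utm by (auto simp: valid_acts_def utm_def)
  qed
  moreover have "3 \<le> tapes (utm a b K)" using utm by simp
  ultimately show ?thesis using S(1,2) utm unfolding turing_machine_def by blast
qed

text \<open>The pair after a move to the left. As a constant it also covers the empty left half,
  where the head arrives on the blank before the word; the loops that run leftwards can thus be
  treated by induction on \<open>l\<close>.\<close>

definition movl :: "'a symbol list \<Rightarrow> 'a symbol list \<Rightarrow> 'a symbol list \<times> 'a symbol list" where
  "movl l r = (tl l, bcons (hd_or Blank l) r)"

lemma ztop_movl [simp]: "ztop (movl l r) = hd_or Blank l"
  by (simp add: movl_def)

lemma zact_movl [simp]:
  "zact (s, MoveLeft) (l, r) = movl l (bcons s (tl r))"
  "zact (s, MoveLeft) (movl l r) = movl (tl l) (bcons s r)"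
  "zact (Blank, MoveRight) (movl [] r) = ([], r)"
  by (simp_all add: movl_def)

declare zact.simps(1) [simp del] zstep.simps [simp del]

text \<open>\<open>l0\<close> and \<open>l1\<close> hold what has been passed on the input tapes
  (the code and consumed letters). They are never read again and are therefore quantified away
  later. The output head stands behind the last letter of \<open>y\<close>.\<close>

definition config :: "'a symbol list \<Rightarrow> 'a symbol list \<Rightarrow> 'a symbol list \<Rightarrow> 'a symbol list \<Rightarrow> 'a rconfig \<Rightarrow>
    nat \<times> ('a symbol list \<times> 'a symbol list) list" where
  "config l0 l1 l r = (\<lambda>(w, p, x, y). (to_nat Run, [(l0, map Letter p), (l1, map Letter x), (rev (map Letter y), []),
     (l, r), ([], map msym w), ([], [])]))"

lemma steps_through: "steps f c d \<Longrightarrow> steps f d e \<Longrightarrow> c \<noteq> d \<Longrightarrow> steps1 f c e"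
  by (drule rtranclpD) (auto intro: tranclp_rtranclp_tranclp)

lemma zact_consume:
  "zact (osym (head p), if c then MoveRight else Stay) (l, map Letter p) =
    (if c then bcons (osym (head p)) l else l, map Letter (consume c p))"
  by (simp add: consume_def map_tl)

lemma zact_out:
  "s' = Blank \<Longrightarrow> zact (case o' of None \<Rightarrow> (s', Stay) | Some s \<Rightarrow> (Letter s, MoveRight)) (rev (map Letter y), []) =
    (rev (map Letter (y @ (case o' of None \<Rightarrow> [] | Some s \<Rightarrow> [s]))), [])"
  by (simp split: option.splits)

section \<open>Programs and their codes\<close>

fun rule_text :: "'a rule \<Rightarrow> 'a instr list" where
  "rule_text (es, c, d, o') = map Edit es @ [End c d o']"

definition program_text :: "'a rule list \<Rightarrow> 'a instr list" where
  "program_text rs = concat (map rule_text rs) @ [Stop]"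

text \<open>
  The instruction with number \<open>j\<close> is written \<open>a\<^sup>jb\<close>. As \<^const>\<open>Stop\<close> occurs only at the end of a
  program, the code of a program is self-delimiting.
\<close>

definition token :: "'a \<Rightarrow> 'a \<Rightarrow> 'a::finite instr \<Rightarrow> 'a list" where
  "token a b i = replicate (to_nat i) a @ [b]"

definition rcode :: "'a \<Rightarrow> 'a \<Rightarrow> 'a::finite rule list \<Rightarrow> 'a list" where
  "rcode a b rs = concat (map (token a b) (program_text rs))"

locale universal =
  fixes a b :: "'a::finite" and K :: nat
  assumes ab: "a \<noteq> b" and K: "code_bound K TYPE('a)"
begin

abbreviation "U \<equiv> utm a b K"

lemma zstep_utm:
  "zstep U (to_nat q, zs) =
     map_option (\<lambda>(q', as). (to_nat q', map2 zact as zs)) (udelta a b K q (map ztop zs))"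
  by (auto simp: zstep.simps utm_def split: option.splits)

lemmas usimps = zstep_utm stay_def numeral_eq_Suc Let_def

section \<open>Rewinding, erasing and copying loops\<close>

lemma rewind_prog:
  assumes "Blank \<notin> set l"
  shows "steps (zstep U) (to_nat RewindProg, [z0, z1, z2, movl l r, z4, z5])
    (to_nat Run, [z0, z1, z2, ([], rev l @ r), z4, z5])"
  using assms
proof (induction l arbitrary: r)
  case Nil
  show ?case by (rule r_into_rtranclp) (simp add: usimps)
next
  case (Cons s l)
  show ?case using Cons.prems by simp (rule steps_step[OF _ Cons.IH], auto simp: usimps)
qed

lemma rewind_main:
  assumes "Blank \<notin> set l"
  shows "steps (zstep U) (to_nat RewindMain, [z0, z1, z2, z3, movl l r, z5])
    (to_nat EraseScratch, [z0, z1, z2, z3, ([], rev l @ r), z5])"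
  using assms
proof (induction l arbitrary: r)
  case Nil
  show ?case by (rule r_into_rtranclp) (simp add: usimps)
next
  case (Cons s l)
  show ?case using Cons.prems by simp (rule steps_step[OF _ Cons.IH], auto simp: usimps)
qed

lemma rewind_out:
  assumes "Blank \<notin> set l"
  shows "steps (zstep U) (to_nat RewindOut, [z0, z1, movl l r, z3, z4, z5])
    (to_nat Halt, [z0, z1, ([], rev l @ r), z3, z4, z5])"
  using assms
proof (induction l arbitrary: r)
  case Nil
  show ?case by (rule r_into_rtranclp) (simp add: usimps)
next
  case (Cons s l)
  show ?case using Cons.prems by simp (rule steps_step[OF _ Cons.IH], auto simp: usimps)
qed

lemma erase_main:
  assumes "Blank \<notin> set l"
  shows "steps (zstep U) (to_nat EraseMain, [z0, z1, z2, z3, movl l [], z5])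
    (to_nat CopyBack, [z0, z1, z2, z3, movl [] [], z5])"
  using assms
proof (induction l)
  case Nil
  show ?case by (rule r_into_rtranclp) (simp add: usimps movl_def)
next
  case (Cons s l)
  then show ?case by (intro steps_step[OF _ Cons.IH]) (auto simp: usimps)
qed

lemma erase_scratch:
  assumes "Blank \<notin> set l"
  shows "steps (zstep U) (to_nat EraseScratch, [z0, z1, z2, z3, z4, movl l []])
    (to_nat SkipRule, [z0, z1, z2, z3, z4, ([], [])])"
  using assms
proof (induction l)
  case Nil
  show ?case by (rule r_into_rtranclp) (simp add: usimps movl_def)
next
  case (Cons s l)
  then show ?case by (intro steps_step[OF _ Cons.IH]) (auto simp: usimps)
qed

lemma copy_back:
  assumes "Blank \<notin> set l"
  shows "steps (zstep U) (to_nat CopyBack, [z0, z1, z2, z3, movl [] r, movl l []])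
    (to_nat RewindProg, [z0, z1, z2, z3, ([], rev l @ r), ([], [])])"
  using assms
proof (induction l arbitrary: r)
  case Nil
  show ?case by (rule r_into_rtranclp) (simp add: usimps movl_def)
next
  case (Cons s l)
  show ?case using Cons.prems by simp (rule steps_step[OF _ Cons.IH], auto simp: usimps)
qed

lemma skip_rule:
  "steps (zstep U) (to_nat SkipRule, [z0, z1, z2, (l, map isym (map Edit es) @ isym (End u v d) # r), z4, z5])
    (to_nat Run, [z0, z1, z2, (rev (map isym (map Edit es @ [End u v d])) @ l, r), z4, z5])"
proof (induction es arbitrary: l)
  case Nil
  show ?case by (rule r_into_rtranclp) (auto simp: usimps)
next
  case (Cons e es)
  show ?case by simp (rule steps_step[OF _ Cons.IH[simplified]], simp add: usimps)
qed

section \<open>Running one edit script\<close>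

lemma zstep_run:
  "zstep U (to_nat Run, [z0, z1, z2, (l, isym i # r), z4, z5]) =
     map_option (\<lambda>(q', as). (to_nat q', map2 zact as [z0, z1, z2, (l, isym i # r), z4, z5]))
       (urun i [ztop z0, ztop z1, ztop z2, isym i, ztop z4, ztop z5])"
  by (simp add: zstep_utm isym_def)

lemma copy_stack:
  "steps (zstep U) (to_nat Run, [z0, z1, z2, (l, isym (Edit Next) # r), (ml, map msym w), (sl, [])])
    (to_nat Run, [z0, z1, z2, (l, isym (Edit Next) # r),
      (rev (map msym (takeWhile (\<lambda>z. z \<noteq> None) w)) @ ml, map msym (dropWhile (\<lambda>z. z \<noteq> None) w)),
      (rev (map msym (takeWhile (\<lambda>z. z \<noteq> None) w)) @ sl, [])])"
proof (induction w arbitrary: ml sl)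
  case (Cons z w)
  show ?case
  proof (cases z)
    case (Some c)
    then show ?thesis
      by simp (rule steps_step[OF _ Cons.IH[simplified]], simp add: zstep_run stay_def numeral_eq_Suc Let_def)
  qed simp
qed simp

text \<open>The equation for \<open>ml'\<close> and \<open>w'\<close> records that tape 4 keeps its
  content and only its head moves, which is what a later failure relies on.\<close>

lemma run_edit_Some:
  assumes "edit1 u v e w = Some (y, w')" "ztop z0 = osym u" "ztop z1 = osym v"
  shows "\<exists>ml'. rev ml' @ w' = rev ml @ w \<and>
    steps (zstep U) (to_nat Run, [z0, z1, z2, (l, isym (Edit e) # r), (map msym ml, map msym w), (sl, [])])
      (to_nat Run, [z0, z1, z2, (isym (Edit e) # l, r), (map msym ml', map msym w'), (rev (map msym y) @ sl, [])])"
proof (cases e)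
  case (Match c)
  show ?thesis
  proof (cases "head w = Some (Some c)")
    case True
    then obtain w1 where w: "w = Some c # w1" by (cases w) auto
    show ?thesis
      using assms(1) Match w
      by (intro exI[of _ "Some c # ml"] conjI r_into_rtranclp)
        (auto simp: zstep_run stay_def numeral_eq_Suc Let_def)
  next
    case False
    show ?thesis
      using assms(1) Match False
      by (intro exI[of _ ml] conjI r_into_rtranclp; cases w)
        (auto simp: zstep_run stay_def numeral_eq_Suc Let_def split: if_splits)
  qed
next
  case (Emit c)
  then show ?thesis
    using assms(1) by (intro exI[of _ ml] conjI r_into_rtranclp)
      (auto simp: zstep_run stay_def numeral_eq_Suc Let_def)
next
  case Next
  define t where "t = takeWhile (\<lambda>z. z \<noteq> None) w"
  define d where "d = dropWhile (\<lambda>z. z \<noteq> None) w"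
  have w: "t @ d = w" by (simp add: t_def d_def)
  have d: "d = [] \<or> (\<exists>w1. d = None # w1)"
    using hd_dropWhile[of "\<lambda>z. z \<noteq> None" w] unfolding d_def[symmetric] by (cases d) auto
  have y: "y = t @ [None]" "w' = tl d"
    using assms(1) unfolding Next t_def d_def by simp_all
  \<comment> \<open>At the end of the word there is no separator to step over: \<open>None\<close>
    is written on tape 5, but the head of tape 4 stays.\<close>
  define ml' where "ml' = (if d = [] then [] else [None]) @ rev t @ ml"
  have 1: "zstep U (to_nat Run, [z0, z1, z2, (l, isym (Edit Next) # r),
      (rev (map msym t) @ map msym ml, map msym d), (rev (map msym t) @ sl, [])]) =
    Some (to_nat Run, [z0, z1, z2, (isym (Edit Next) # l, r),
      (map msym ml', map msym (tl d)), (rev (map msym (t @ [None])) @ sl, [])])"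
    using d by (auto simp: zstep_run stay_def numeral_eq_Suc Let_def ml'_def rev_map)
  note 2 = copy_stack[of z0 z1 z2 l r "map msym ml" w sl, folded t_def d_def]
  have "rev ml' @ tl d = rev ml @ w"
    using d w by (auto simp: ml'_def)
  then show ?thesis
    unfolding y Next using rtranclp.rtrancl_into_rtrancl[OF 2, of "_ :: _ \<times> _"] 1
    by (intro exI[of _ ml'] conjI) blast+
next
  case (Look u' v')
  then show ?thesis
    using assms zact_stay[of z0] zact_stay[of z1] zact_stay[of z2]
    by (intro exI[of _ ml] conjI r_into_rtranclp)
      (auto simp: zstep_run stay_def numeral_eq_Suc Let_def simp del: zact_stay split: if_splits)
qed

lemma run_edit_None:
  assumes "edit1 u v e w = None" "ztop z0 = osym u" "ztop z1 = osym v"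
  shows "zstep U (to_nat Run, [z0, z1, z2, (l, isym (Edit e) # r), (map msym ml, map msym w), (sl, [])]) =
      Some (to_nat RewindMain, [z0, z1, z2, (l, isym (Edit e) # r), movl (map msym ml) (map msym w), movl sl []])"
proof (cases e)
  case (Match c)
  then show ?thesis
    using assms zact_stay[of z0] zact_stay[of z1] zact_stay[of z2]
    by (cases w)
      (auto simp: zstep_run stay_def numeral_eq_Suc Let_def simp del: zact_stay split: if_splits)
next
  case (Look u' v')
  then show ?thesis
    using assms zact_stay[of z0] zact_stay[of z1] zact_stay[of z2]
    by (cases w)
      (auto simp: zstep_run stay_def numeral_eq_Suc Let_def simp del: zact_stay split: if_splits)
qed (use assms in simp_all)

lemma exec_Some:
  assumes "exec u v es w = Some w'" "ztop z0 = osym u" "ztop z1 = osym v"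
  shows "\<exists>ml' mr. rev ml' @ mr = rev ml @ w \<and>
    steps (zstep U) (to_nat Run, [z0, z1, z2, (l, map isym (map Edit es) @ r), (map msym ml, map msym w), (sl, [])])
      (to_nat Run, [z0, z1, z2, (rev (map isym (map Edit es)) @ l, r), (map msym ml', map msym mr),
        (rev (map msym w') @ sl, [])])"
  using assms(1)
proof (induction es arbitrary: w w' l ml sl)
  case Nil
  then show ?case by auto
next
  case (Cons e es)
  obtain y w1 w2 where w: "edit1 u v e w = Some (y, w1)" "exec u v es w1 = Some w2" "w' = y @ w2"
    using Cons.prems by (auto split: option.splits)
  obtain ml1 where 1: "rev ml1 @ w1 = rev ml @ w"
    "steps (zstep U) (to_nat Run, [z0, z1, z2, (l, map isym (map Edit (e # es)) @ r), (map msym ml, map msym w), (sl, [])])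
      (to_nat Run, [z0, z1, z2, (isym (Edit e) # l, map isym (map Edit es) @ r), (map msym ml1, map msym w1),
        (rev (map msym y) @ sl, [])])"
    using run_edit_Some[OF w(1) assms(2,3), of ml z2 l "map isym (map Edit es) @ r" sl] by auto
  show ?case
    using Cons.IH[OF w(2), of ml1 "isym (Edit e) # l" "rev (map msym y) @ sl"] 1 w(3)
    by simp (meson rtranclp_trans)
qed

text \<open>The script may fail at any command: \<open>es2\<close> is what remains to be skipped,
  and \<open>w'\<close> the partial output that remains to be erased.\<close>

lemma exec_None:
  assumes "exec u v es w = None" "ztop z0 = osym u" "ztop z1 = osym v"
  shows "\<exists>ml' mr w' es1 es2. rev ml' @ mr = rev ml @ w \<and> es = es1 @ es2 \<and>
    steps (zstep U) (to_nat Run, [z0, z1, z2, (l, map isym (map Edit es) @ r), (map msym ml, map msym w), (map msym sl, [])])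
      (to_nat RewindMain, [z0, z1, z2, (rev (map isym (map Edit es1)) @ l, map isym (map Edit es2) @ r),
        movl (map msym ml') (map msym mr), movl (map msym w') []])"
  using assms(1)
proof (induction es arbitrary: w l ml sl)
  case (Cons e es)
  show ?case
  proof (cases "edit1 u v e w")
    case None
    note 1 = r_into_rtranclp[of "\<lambda>c d. zstep U c = Some d", OF run_edit_None[OF None assms(2,3)]]
    show ?thesis
      using 1[of z2 l "map isym (map Edit es) @ r" ml "map msym sl"]
      by (intro exI[of _ ml] exI[of _ w] exI[of _ sl] exI[of _ "[]"] exI[of _ "e # es"]) auto
  next
    case (Some yw)
    then obtain y w1 where w: "edit1 u v e w = Some (y, w1)" "exec u v es w1 = None"
      using Cons.prems by (cases yw) (auto split: option.splits)
    obtain ml1 where 1: "rev ml1 @ w1 = rev ml @ w"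
      "steps (zstep U) (to_nat Run, [z0, z1, z2, (l, map isym (map Edit (e # es)) @ r), (map msym ml, map msym w), (map msym sl, [])])
        (to_nat Run, [z0, z1, z2, (isym (Edit e) # l, map isym (map Edit es) @ r), (map msym ml1, map msym w1),
          (map msym (rev y @ sl), [])])"
      using run_edit_Some[OF w(1) assms(2,3), of ml z2 l "map isym (map Edit es) @ r" "map msym sl"]
      by (auto simp: rev_map)
    obtain ml' mr w' es1 es2 where 2: "rev ml' @ mr = rev ml1 @ w1" "es = es1 @ es2"
      "steps (zstep U) (to_nat Run, [z0, z1, z2, (isym (Edit e) # l, map isym (map Edit es) @ r), (map msym ml1, map msym w1),
          (map msym (rev y @ sl), [])])
        (to_nat RewindMain, [z0, z1, z2, (rev (map isym (map Edit es1)) @ isym (Edit e) # l, map isym (map Edit es2) @ r),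
          movl (map msym ml') (map msym mr), movl (map msym w') []])"
      using Cons.IH[OF w(2), of ml1 "isym (Edit e) # l" "rev y @ sl"]
      by (elim exE conjE) (rule that)
    then show ?thesis
      using rtranclp_trans[OF 1(2) 2(3)] 1(1)
      by (intro exI[of _ ml'] exI[of _ mr] exI[of _ w'] exI[of _ "e # es1"] exI[of _ es2]) auto
  qed
qed simp

section \<open>Failure and success of a single rule\<close>

lemma fail_rule:
  assumes "exec u v es w = None" "ztop z0 = osym u" "ztop z1 = osym v"
  shows "steps (zstep U)
    (to_nat Run, [z0, z1, z2, (l, map isym (map Edit es @ [End c d o']) @ r), ([], map msym w), ([], [])])
    (to_nat Run, [z0, z1, z2, (rev (map isym (map Edit es @ [End c d o'])) @ l, r), ([], map msym w), ([], [])])"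
proof -
  have blank: "Blank \<notin> set (map msym xs)" for xs :: "bool option list" by auto
  obtain ml' mr w' es1 es2 where 1: "rev ml' @ mr = w" "es = es1 @ es2"
    "steps (zstep U) (to_nat Run, [z0, z1, z2, (l, map isym (map Edit es) @ isym (End c d o') # r), ([], map msym w), ([], [])])
      (to_nat RewindMain, [z0, z1, z2, (rev (map isym (map Edit es1)) @ l, map isym (map Edit es2) @ isym (End c d o') # r),
        movl (map msym ml') (map msym mr), movl (map msym w') []])"
    using exec_None[OF assms, of "[]" z2 l "isym (End c d o') # r" "[]"] by auto
  note 1(3)
  also note rewind_main[OF blank]
  also note erase_scratch[OF blank]
  also note skip_rule
  finally show ?thesis using 1(1,2) by (auto simp: rev_map)
qed

lemma skip_main:
  "steps (zstep U)
    (to_nat Run, [z0, z1, z2, (l, isym (End c d o') # r), (map msym ml, map msym w), z5])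
    (to_nat Run, [z0, z1, z2, (l, isym (End c d o') # r), (map msym (rev w @ ml), []), z5])"
proof (induction w arbitrary: ml)
  case (Cons z w)
  show ?case
    by simp (rule steps_step[OF _ Cons.IH[of "z # ml", simplified]],
        simp add: zstep_run stay_def numeral_eq_Suc Let_def)
qed simp

lemma end_rule:
  "zstep U (to_nat Run, [(l0, map Letter p), (l1, map Letter x), (rev (map Letter y), []),
      (l, isym (End c d o') # r), (m, []), (s, [])]) =
    Some (to_nat EraseMain, [(if c then bcons (osym (head p)) l0 else l0, map Letter (consume c p)),
      (if d then bcons (osym (head x)) l1 else l1, map Letter (consume d x)),
      (rev (map Letter (y @ (case o' of None \<Rightarrow> [] | Some s \<Rightarrow> [s]))), []),
      movl l (isym (End c d o') # r), movl m [], movl s []])"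
  unfolding zact_consume[symmetric] by (simp add: zstep_run zact_out del: map_append rev_append)

lemma apply_rule:
  assumes "exec (head p) (head x) es w = Some w'" "Blank \<notin> set l"
  shows "\<exists>l0' l1'. steps1 (zstep U)
    (config l0 l1 l (map isym (map Edit es @ [End c d o']) @ r) (w, p, x, y))
    (config l0' l1' [] (rev l @ map isym (map Edit es @ [End c d o']) @ r)
      (w', consume c p, consume d x, y @ (case o' of None \<Rightarrow> [] | Some s \<Rightarrow> [s])))"
proof -
  have blank: "Blank \<notin> set (map msym xs)" for xs :: "bool option list" by auto
  have blank': "Blank \<notin> set (rev (map isym (map Edit es)) @ l)" using assms(2) by auto
  let ?z0 = "(l0, map Letter p)" and ?z1 = "(l1, map Letter x)" and ?z2 = "(rev (map Letter y), [])"
  let ?e = "isym (End c d o')" and ?es = "map isym (map Edit es)"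
  let ?l0 = "if c then bcons (osym (head p)) l0 else l0" and ?l1 = "if d then bcons (osym (head x)) l1 else l1"
  let ?z0' = "(?l0, map Letter (consume c p))" and ?z1' = "(?l1, map Letter (consume d x))"
    and ?z2' = "(rev (map Letter (y @ (case o' of None \<Rightarrow> [] | Some s \<Rightarrow> [s]))), [])"
  obtain ml' mr where 1: "steps (zstep U) (to_nat Run, [?z0, ?z1, ?z2, (l, ?es @ ?e # r), ([], map msym w), ([], [])])
      (to_nat Run, [?z0, ?z1, ?z2, (rev ?es @ l, ?e # r), (map msym ml', map msym mr), (map msym (rev w'), [])])"
    using exec_Some[OF assms(1), of ?z0 ?z1 "[]" ?z2 l "?e # r" "[]"] by (auto simp: rev_map)
  note 2 = skip_main[of ?z0 ?z1 ?z2 "rev ?es @ l" c d o' r ml' mr "(map msym (rev w'), [])"]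
  note 3 = end_rule[of l0 p l1 x y "rev ?es @ l" c d o' r "map msym (rev mr @ ml')" "map msym (rev w')"]
  note 4 = erase_main[OF blank, of ?z0' ?z1' ?z2' "movl (rev ?es @ l) (?e # r)" "rev mr @ ml'" "movl (map msym (rev w')) []"]
  note 5 = copy_back[OF blank, of ?z0' ?z1' ?z2' "movl (rev ?es @ l) (?e # r)" "[]" "rev w'"]
  have "steps (zstep U) (to_nat Run, [?z0, ?z1, ?z2, (l, ?es @ ?e # r), ([], map msym w), ([], [])])
    (to_nat RewindProg, [?z0', ?z1', ?z2', movl (rev ?es @ l) (?e # r), ([], rev (map msym (rev w')) @ []), ([], [])])"
    by (rule rtranclp_trans[OF 1 rtranclp_trans[OF 2 steps_step[OF 3 rtranclp_trans[OF 4 5]]]])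
  then have "steps (zstep U) (to_nat Run, [?z0, ?z1, ?z2, (l, ?es @ ?e # r), ([], map msym w), ([], [])])
    (to_nat RewindProg, [?z0', ?z1', ?z2', movl (rev ?es @ l) (?e # r), ([], map msym w'), ([], [])])"
    by (simp only: rev_map rev_rev_ident append_Nil2)
  moreover have "steps (zstep U) (to_nat RewindProg, [?z0', ?z1', ?z2', movl (rev ?es @ l) (?e # r), ([], map msym w'), ([], [])])
    (to_nat Run, [?z0', ?z1', ?z2', ([], rev l @ ?es @ ?e # r), ([], map msym w'), ([], [])])"
    using rewind_prog[OF blank', of ?z0' ?z1' ?z2' "?e # r" "([], map msym w')" "([], [])"] by simp
  \<comment> \<open>The states \<open>Run\<close> and \<open>RewindProg\<close> differ, so the first
    run is nonempty, as \<open>simulation\<close> requires.\<close>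
  ultimately have "steps1 (zstep U) (to_nat Run, [?z0, ?z1, ?z2, (l, ?es @ ?e # r), ([], map msym w), ([], [])])
    (to_nat Run, [?z0', ?z1', ?z2', ([], rev l @ ?es @ ?e # r), ([], map msym w'), ([], [])])"
    by (rule steps_through) simp
  then show ?thesis unfolding config_def by (intro exI[of _ ?l0] exI[of _ ?l1]) simp
qed

section \<open>Searching the list of rules\<close>

lemma run_rules_None:
  assumes "rstep rs (w, p, x, y) = None"
  shows "\<exists>l'. steps (zstep U) (config l0 l1 l (map isym (program_text rs)) (w, p, x, y))
    (config l0 l1 l' [isym Stop] (w, p, x, y))"
  using assms
proof (induction rs arbitrary: l)
  case Nil
  then show ?case by (auto simp: program_text_def)
next
  case (Cons r rs)
  obtain es c d o' where r: "r = (es, c, d, o')" by (cases r)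
  have None: "exec (head p) (head x) es w = None" "rstep rs (w, p, x, y) = None"
    using Cons.prems by (auto simp: r split: option.splits)
  let ?l = "rev (map isym (map Edit es @ [End c d o'])) @ l"
  have "steps (zstep U) (config l0 l1 l (map isym (program_text (r # rs))) (w, p, x, y))
      (config l0 l1 ?l (map isym (program_text rs)) (w, p, x, y))"
    using fail_rule[OF None(1), where ?z0.0 = "(l0, map Letter p)" and ?z1.0 = "(l1, map Letter x)" and ?r = "map isym (program_text rs)"]
    by (simp add: config_def program_text_def r)
  with Cons.IH[OF None(2), of ?l] show ?case by (meson rtranclp_trans)
qed

lemma run_rules_Some:
  assumes "rstep rs (w, p, x, y) = Some C" "Blank \<notin> set l"
  shows "\<exists>l0' l1'. steps1 (zstep U) (config l0 l1 l (map isym (program_text rs)) (w, p, x, y))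
    (config l0' l1' [] (rev l @ map isym (program_text rs)) C)"
  using assms
proof (induction rs arbitrary: l)
  case (Cons r rs)
  obtain es c d o' where r: "r = (es, c, d, o')" by (cases r)
  show ?case
  proof (cases "exec (head p) (head x) es w")
    case None
    then have Some: "rstep rs (w, p, x, y) = Some C" using Cons.prems by (simp add: r)
    let ?l = "rev (map isym (map Edit es @ [End c d o'])) @ l"
    have "steps (zstep U) (config l0 l1 l (map isym (program_text (r # rs))) (w, p, x, y))
        (config l0 l1 ?l (map isym (program_text rs)) (w, p, x, y))"
      using fail_rule[OF None, where ?z0.0 = "(l0, map Letter p)" and ?z1.0 = "(l1, map Letter x)" and ?r = "map isym (program_text rs)"]
      by (simp add: config_def program_text_def r)
    moreover obtain l0' l1' where "steps1 (zstep U) (config l0 l1 ?l (map isym (program_text rs)) (w, p, x, y))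
        (config l0' l1' [] (rev ?l @ map isym (program_text rs)) C)"
      using Cons.IH[OF Some, of ?l] Cons.prems(2) by (auto simp: image_iff)
    ultimately have "steps1 (zstep U) (config l0 l1 l (map isym (program_text (r # rs))) (w, p, x, y))
        (config l0' l1' [] (rev ?l @ map isym (program_text rs)) C)"
      by (rule rtranclp_tranclp_tranclp)
    then show ?thesis by (intro exI[of _ l0'] exI[of _ l1']) (simp add: program_text_def r)
  next
    case (Some w')
    have "C = (w', consume c p, consume d x, y @ (case o' of None \<Rightarrow> [] | Some s \<Rightarrow> [s]))"
      using Some Cons.prems(1) by (simp add: r)
    then show ?thesis
      using apply_rule[OF Some Cons.prems(2), where ?r = "map isym (program_text rs)"]
      by (simp add: program_text_def r)
  qed
qed simp

text \<open>As \<open>reads_word\<close> starts at the head, the output head must return to the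
  first letter; the blank before the word tells it where to turn.\<close>

lemma run_stop:
  "\<exists>zs. halts_at (zstep U) (config l0 l1 l [isym Stop] (w, p, x, y)) (to_nat Halt, zs) \<and>
    length zs = 6 \<and> zs ! 2 = ([], map Letter y)"
proof -
  let ?z = "\<lambda>z. [(l0, map Letter p), (l1, map Letter x), z, (l, [isym Stop]), ([], map msym w), ([], [])]"
  have "zstep U (config l0 l1 l [isym Stop] (w, p, x, y)) = Some (to_nat RewindOut, ?z (movl (rev (map Letter y)) []))"
    by (simp add: config_def zstep_run stay_def numeral_eq_Suc)
  moreover have "steps (zstep U) (to_nat RewindOut, ?z (movl (rev (map Letter y)) [])) (to_nat Halt, ?z ([], map Letter y))"
    using rewind_out[where ?l = "rev (map Letter y)" and ?r = "[]"] by (simp add: image_iff)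
  ultimately have "steps (zstep U) (config l0 l1 l [isym Stop] (w, p, x, y)) (to_nat Halt, ?z ([], map Letter y))"
    by (rule steps_step)
  moreover have "zstep U (to_nat Halt, zs) = None" for zs by (simp add: zstep_utm)
  ultimately show ?thesis by (intro exI[of _ "?z ([], map Letter y)"]) (simp add: halts_at_def)
qed

section \<open>Loading the program from the first input tape\<close>

lemma load_replicate:
  assumes "j + n \<le> K"
  shows "\<exists>l0'. steps (zstep U) (to_nat (Load j), [(l0, map Letter (replicate n a @ v)), z1, z2, z3, z4, z5])
    (to_nat (Load (j + n)), [(l0', map Letter v), z1, z2, z3, z4, z5])"
  using assms
proof (induction n arbitrary: j l0)
  case (Suc n)
  have "zstep U (to_nat (Load j), [(l0, map Letter (replicate (Suc n) a @ v)), z1, z2, z3, z4, z5]) =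
    Some (to_nat (Load (Suc j)), [(Letter a # l0, map Letter (replicate n a @ v)), z1, z2, z3, z4, z5])"
    using Suc.prems by (simp add: zstep_utm stay_def)
  moreover obtain l0' where "steps (zstep U) (to_nat (Load (Suc j)), [(Letter a # l0, map Letter (replicate n a @ v)), z1, z2, z3, z4, z5])
    (to_nat (Load (Suc j + n)), [(l0', map Letter v), z1, z2, z3, z4, z5])"
    using Suc.IH[of "Suc j" "Letter a # l0"] Suc.prems by auto
  ultimately show ?case by (intro exI[of _ l0']) (simp add: steps_step)
qed auto

lemma load_token:
  "\<exists>l0'. steps (zstep U) (to_nat (Load 0), [(l0, map Letter (token a b i @ v)), z1, z2, (l, []), z4, z5])
    (if i = Stop then (to_nat RewindProg, [(l0', map Letter v), z1, z2, movl l [isym Stop], z4, z5])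
     else (to_nat (Load 0), [(l0', map Letter v), z1, z2, (isym i # l, []), z4, z5]))"
proof -
  have "to_nat i \<le> K" using K by (auto simp: code_bound_def)
  then obtain l1 where
    1: "steps (zstep U) (to_nat (Load 0), [(l0, map Letter (replicate (to_nat i) a @ b # v)), z1, z2, (l, []), z4, z5])
      (to_nat (Load (to_nat i)), [(l1, map Letter (b # v)), z1, z2, (l, []), z4, z5])"
    using load_replicate[of 0 "to_nat i" l0 "b # v" z1 z2 "(l, [])" z4 z5] by auto
  have "zstep U (to_nat (Load (to_nat i)), [(l1, map Letter (b # v)), z1, z2, (l, []), z4, z5]) =
    Some (if i = Stop then (to_nat RewindProg, [(Letter b # l1, map Letter v), z1, z2, movl l [isym Stop], z4, z5])
     else (to_nat (Load 0), [(Letter b # l1, map Letter v), z1, z2, (isym i # l, []), z4, z5]))"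
    using ab by (auto simp: zstep_utm stay_def numeral_eq_Suc isym_def)
  with 1 show ?thesis
    by (intro exI[of _ "Letter b # l1"]) (simp add: token_def rtranclp.rtrancl_into_rtrancl)
qed

lemma load_program:
  assumes "Stop \<notin> set is" "Blank \<notin> set l"
  shows "\<exists>l0'. steps (zstep U)
    (to_nat (Load 0), [(l0, map Letter (concat (map (token a b) (is @ [Stop])) @ v)), z1, z2, (l, []), z4, z5])
    (to_nat Run, [(l0', map Letter v), z1, z2, ([], rev l @ map isym (is @ [Stop])), z4, z5])"
  using assms
proof (induction "is" arbitrary: l0 l)
  case Nil
  obtain l0' where "steps (zstep U) (to_nat (Load 0), [(l0, map Letter (token a b Stop @ v)), z1, z2, (l, []), z4, z5])
      (to_nat RewindProg, [(l0', map Letter v), z1, z2, movl l [isym Stop], z4, z5])"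
    using load_token[of l0 Stop v z1 z2 l z4 z5] by auto
  also note rewind_prog[OF Nil(2)]
  finally show ?case by (intro exI[of _ l0']) simp
next
  case (Cons i "is")
  let ?v = "concat (map (token a b) (is @ [Stop])) @ v"
  obtain l0' where 1: "steps (zstep U) (to_nat (Load 0), [(l0, map Letter (token a b i @ ?v)), z1, z2, (l, []), z4, z5])
      (to_nat (Load 0), [(l0', map Letter ?v), z1, z2, (isym i # l, []), z4, z5])"
    using load_token[of l0 i ?v z1 z2 l z4 z5] Cons.prems(1) by auto
  obtain l0'' where 2: "steps (zstep U) (to_nat (Load 0), [(l0', map Letter ?v), z1, z2, (isym i # l, []), z4, z5])
      (to_nat Run, [(l0'', map Letter v), z1, z2, ([], rev (isym i # l) @ map isym (is @ [Stop])), z4, z5])"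
    using Cons.IH[of "isym i # l" l0'] Cons.prems by auto
  show ?case using rtranclp_trans[OF 1 2] by (intro exI[of _ l0'']) simp
qed

lemma load:
  "\<exists>l0. steps (zstep U) (zinitial U (rcode a b rs @ p) x) (config l0 [] [] (map isym (program_text rs)) ([], p, x, []))"
proof -
  have "Stop \<notin> set (concat (map rule_text rs))" by auto
  from load_program[OF this, of "[]" "[]" p "([], map Letter x)" "([], [])" "([], [])" "([], [])"]
  show ?thesis
    by (simp add: zinitial_def config_def rcode_def program_text_def utm_def numeral_eq_Suc)
qed

lemma yields_utm:
  "yields U (rcode a b rs @ p) x w \<longleftrightarrow>
    (\<exists>C. halts_at (rstep rs) ([], p, x, []) C \<and> snd (snd (snd C)) = w)"
proof -
  let ?t = "map isym (program_text rs)"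
  obtain l0 c where c: "steps (step U) (initial U (rcode a b rs @ p) x) c"
      "crep c (config l0 [] [] ?t ([], p, x, []))"
    using load crep_steps crep_initial by blast
  have "(\<exists>C. halts_at (rstep rs) ([], p, x, []) C \<and> snd (snd (snd C)) = w) \<longleftrightarrow>
    (\<exists>d. halts_at (step U) c d \<and> reads_word (snd d ! 2) w)"
  \<comment> \<open>Only configurations with the program head on the first instruction are compared;
    a whole search through the rules lies between two of them.\<close>
  proof (rule simulation[where rel = "\<lambda>C c. \<exists>l0 l1. crep c (config l0 l1 [] ?t C)"])
    show "\<exists>l0 l1. crep c (config l0 l1 [] ?t ([], p, x, []))" using c(2) by blast
  next
    fix C c' D
    assume "\<exists>l0 l1. crep c' (config l0 l1 [] ?t C)" and step: "rstep rs C = Some D"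
    then obtain l0 l1 where c': "crep c' (config l0 l1 [] ?t C)" by blast
    obtain w p x y where C: "C = (w, p, x, y)" by (cases C)
    obtain l0' l1' where "steps1 (zstep U) (config l0 l1 [] ?t C) (config l0' l1' [] ?t D)"
      using run_rules_Some[of rs w p x y D "[]" l0 l1] step unfolding C by auto
    from crep_steps1[OF this c'] show "\<exists>d. steps1 (step U) c' d \<and> (\<exists>l0 l1. crep d (config l0 l1 [] ?t D))"
      by blast
  next
    fix C c'
    assume "\<exists>l0 l1. crep c' (config l0 l1 [] ?t C)" and step: "rstep rs C = None"
    then obtain l0 l1 where c': "crep c' (config l0 l1 [] ?t C)" by blast
    obtain w p x y where C: "C = (w, p, x, y)" by (cases C)
    obtain l' where 1: "steps (zstep U) (config l0 l1 [] ?t C) (config l0 l1 l' [isym Stop] C)"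
      using run_rules_None[of rs w p x y l0 l1 "[]"] step C by auto
    obtain zs where 2: "halts_at (zstep U) (config l0 l1 l' [isym Stop] C) (to_nat Halt, zs)"
      "length zs = 6" "zs ! 2 = ([], map Letter y)"
      using run_stop unfolding C by blast
    have "halts_at (zstep U) (config l0 l1 [] ?t C) (to_nat Halt, zs)"
      using 2(1) halts_at_steps[OF 1] by blast
    from crep_halts_at[OF this c'] obtain d where d: "halts_at (step U) c' d" "crep d (to_nat Halt, zs)"
      by blast
    have "tape_rep (snd d ! 2) ([], map Letter y)"
      using d(2) 2(2,3) list_all2_nthD2[of tape_rep "snd d" zs 2]
      by (simp add: crep_def del: tape_rep.simps)
    from tape_rep_reads_word[OF this]
    have "\<forall>w. snd (snd (snd C)) = w \<longleftrightarrow> reads_word (snd d ! 2) w"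
      unfolding C by auto
    with d(1) show "\<exists>d. halts_at (step U) c' d \<and> (\<forall>w. snd (snd (snd C)) = w \<longleftrightarrow> reads_word (snd d ! 2) w)"
      by blast
  qed
  then show ?thesis
    unfolding yields_iff_halts_at halts_at_steps[OF c(1)] by blast
qed

end

declare tape_rep.simps [simp del]

section \<open>Compiling machines with streams to rewriting machines\<close>

text \<open>The one-hot code with respect to \<open>L\<close>: an element outside \<open>L\<close>
  gets the zero vector. Leaving the blank out of \<open>L\<close> makes the implicit zeros below a
  stack read as blanks.\<close>

definition bits :: "'b list \<Rightarrow> 'b \<Rightarrow> bool list" where
  "bits L s = map (\<lambda>t. t = s) L"

definition enc :: "'b list \<Rightarrow> 'b list \<Rightarrow> bool list" where
  "enc L xs = concat (map (bits L) xs)"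

lemma enc_simps: "enc L [] = []" "enc L [s] = bits L s"
  by (simp_all add: enc_def)

fun match :: "bool list \<Rightarrow> bool list \<Rightarrow> bool list option" where
  "match [] w = Some w"
| "match (b # u) w =
     (if head w = Some b then match u (tl w)
      else if b \<or> head w = Some True then None else match u w)"

lemma match_append: "length u = length v \<Longrightarrow> match u (v @ w) = (if u = v then Some w else None)"
  by (induction u v rule: list_induct2) auto

lemma match_Nil: "match u [] = (if True \<in> set u then None else Some [])"
  by (induction u) auto

lemma bits_eq_iff:
  assumes "s \<in> insert blank (set L)" "t \<in> insert blank (set L)" "blank \<notin> set L"
  shows "bits L s = bits L t \<longleftrightarrow> s = t"
  using assms unfolding bits_def by auto

text \<open>On a nonempty stack the vectors have equal length and are compared exactly. On an empty
  one only the zero vector passes, which is the code of \<open>blank\<close>. Here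
  \<open>blank\<close> is any element outside \<open>L\<close>, so the lemma serves for states
  too.\<close>

lemma match_enc:
  assumes "blank \<notin> set L" "s \<in> insert blank (set L)" "set xs \<subseteq> insert blank (set L)"
  shows "match (bits L s) (enc L xs) = (if s = hd_or blank xs then Some (enc L (tl xs)) else None)"
proof (cases xs)
  case Nil
  have "True \<in> set (bits L s) \<longleftrightarrow> s \<in> set L" by (auto simp: bits_def image_iff)
  then show ?thesis using assms Nil by (auto simp: enc_def match_Nil)
next
  case (Cons t xs')
  have "length (bits L s) = length (bits L t)" by (simp add: bits_def)
  moreover have "bits L s = bits L t \<longleftrightarrow> s = t" using assms Cons by (intro bits_eq_iff) auto
  ultimately show ?thesis by (simp add: Cons enc_def match_append)
qed

text \<open>A relation rather than an equation with \<open>flat\<close>, because the empty word has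
  to stand for any number of empty stacks.\<close>

fun stacks :: "bool option list \<Rightarrow> bool list list \<Rightarrow> bool" where
  "stacks w [] \<longleftrightarrow> True"
| "stacks w (u # us) \<longleftrightarrow>
     takeWhile (\<lambda>z. z \<noteq> None) w = map Some u \<and> stacks (tl (dropWhile (\<lambda>z. z \<noteq> None) w)) us"

definition flat :: "bool list list \<Rightarrow> bool option list" where
  "flat us = concat (map (\<lambda>u. map Some u @ [None]) us)"

lemma takeWhile_dropWhile_map_Some:
  assumes "r = [] \<or> (\<exists>r'. r = None # r')"
  shows "takeWhile (\<lambda>z. z \<noteq> None) (map Some u @ r) = map Some u"
    "dropWhile (\<lambda>z. z \<noteq> None) (map Some u @ r) = r"
  using assms by (induction u) auto

lemma stacks_flat: "stacks (flat us) us"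
proof (induction us)
  case (Cons u us)
  then show ?case
    using takeWhile_dropWhile_map_Some[of "None # flat us" u] by (simp add: flat_def)
qed simp

lemma stacks_Nil: "stacks [] (replicate n [])"
  by (induction n) auto

lemma map_option_append_Nil [simp]: "map_option ((@) []) z = z"
  by (cases z) simp_all

section \<open>Scripts acting on stacks\<close>

lemma exec_Match:
  assumes "r = [] \<or> (\<exists>r'. r = None # r')"
  shows "exec s0 s1 (map Match u @ es) (map Some v @ r) =
    (case match u v of None \<Rightarrow> None | Some v' \<Rightarrow> exec s0 s1 es (map Some v' @ r))"
proof (induction u arbitrary: v)
  case (Cons b u)
  show ?case
  proof (cases v)
    case Nil
    then show ?thesis using Cons[of "[]"] assms by auto
  next
    case (Cons c v')
    then show ?thesis using Cons.IH[of v'] Cons.IH[of v] by auto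
  qed
qed simp

lemma exec_Emit: "exec s0 s1 (map Emit u @ es) w = map_option ((@) (map Some u)) (exec s0 s1 es w)"
  by (induction u) (auto simp: option.map_comp comp_def option.map_ident)

definition edit_stack :: "bool list \<times> bool list \<Rightarrow> 'a edit list" where
  "edit_stack e = map Match (fst e) @ map Emit (snd e) @ [Next]"

fun edit_stacks :: "(bool list \<times> bool list) list \<Rightarrow> bool list list \<Rightarrow> bool list list option" where
  "edit_stacks (e # es) (x # xs) =
     (case match (fst e) x of None \<Rightarrow> None
      | Some x' \<Rightarrow> map_option ((#) (snd e @ x')) (edit_stacks es xs))"
| "edit_stacks _ _ = Some []"

text \<open>Each \<open>Next\<close> writes its separator even where \<open>w\<close> lacks it, so
  the result has the exact form \<open>flat\<close>.\<close>

lemma exec_edit_stacks: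
  assumes "stacks w xs" "length es = length xs"
  shows "exec s0 s1 (concat (map edit_stack es)) w = map_option flat (edit_stacks es xs)"
  using assms(2,1)
proof (induction es xs arbitrary: w rule: list_induct2)
  case Nil
  then show ?case by (simp add: flat_def)
next
  case (Cons e es x xs)
  define r where "r = dropWhile (\<lambda>z. z \<noteq> None) w"
  have w: "w = map Some x @ r"
    using Cons.prems takeWhile_dropWhile_id[of "\<lambda>z. z \<noteq> None" w] by (simp add: r_def)
  have r: "r = [] \<or> (\<exists>r'. r = None # r')"
    using hd_dropWhile[of "\<lambda>z. z \<noteq> None" w] unfolding r_def[symmetric] by (cases r) auto
  have IH: "exec s0 s1 (concat (map edit_stack es)) (tl r) = map_option flat (edit_stacks es xs)"
    using Cons.IH[of "tl r"] Cons.prems unfolding r_def by simp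
  have Next: "exec s0 s1 (Next # es') (map Some x' @ r) = map_option ((@) (map Some x' @ [None])) (exec s0 s1 es' (tl r))" for x' es'
    using takeWhile_dropWhile_map_Some[OF r, of x'] by (simp del: not_None_eq)
  have "exec s0 s1 (edit_stack e @ es') w = (case match (fst e) x of None \<Rightarrow> None
    | Some x' \<Rightarrow> map_option ((@) (map Some (snd e @ x') @ [None])) (exec s0 s1 es' (tl r)))" for es'
    by (cases "exec s0 s1 es' (tl r)") (auto simp: w edit_stack_def exec_Match[OF r] exec_Emit Next
        simp del: exec.simps edit1.simps split: option.splits)
  then show ?case
    by (auto simp: IH flat_def option.map_comp comp_def split: option.splits)
qed

lemma edit_stacks_enc:
  assumes "length tops = length pushes" "length pushes = length xss" "blank \<notin> set L"
    "set tops \<subseteq> insert blank (set L)" "\<forall>xs\<in>set xss. set xs \<subseteq> insert blank (set L)"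
  shows "edit_stacks (map2 (\<lambda>s n. (bits L s, enc L n)) tops pushes) (map (enc L) xss) =
    (if tops = map (hd_or blank) xss then Some (map (enc L) (map2 (\<lambda>n xs. n @ tl xs) pushes xss)) else None)"
  using assms
proof (induction tops pushes xss rule: list_induct3)
  case (Cons s tops n pushes xs xss)
  have "match (bits L s) (enc L xs) = (if s = hd_or blank xs then Some (enc L (tl xs)) else None)"
    using Cons.prems by (intro match_enc) auto
  with Cons show ?case by (auto simp: enc_def)
qed simp

text \<open>At most the rule of the key \<open>k0\<close> fits, so the order of the rules does not
  matter and any enumeration of the keys will do.\<close>

lemma rstep_map_keys:
  assumes "\<And>k. k \<in> set ks \<Longrightarrow> k \<noteq> k0 \<Longrightarrow> exec (head p) (head x) (fst (f k)) w = None"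
    and "k0 \<in> set ks \<Longrightarrow> f k0 = (es, c, d, o') \<and> exec (head p) (head x) es w = Some w'"
  shows "rstep (map f ks) (w, p, x, y) =
    (if k0 \<in> set ks
     then Some (w', consume c p, consume d x, y @ (case o' of None \<Rightarrow> [] | Some l \<Rightarrow> [l])) else None)"
  using assms
proof (induction ks)
  case (Cons k ks)
  show ?case
  proof (cases "k = k0")
    case True
    then show ?thesis using Cons.prems(2) by simp
  next
    case False
    have "rstep (map f (k # ks)) (w, p, x, y) = rstep (map f ks) (w, p, x, y)"
      using Cons.prems(1)[of k] False by (cases "f k") simp
    then show ?thesis using Cons False by simp
  qed
qed simp

text \<open>
  A machine with streams is a Turing machine whose tapes are initially blank; it also sees the heads
  of two input words, which it may consume, and it appends letters to an output word.
\<close>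

type_synonym ('q, 'a) sdelta = "'q \<Rightarrow> 'a symbol list \<Rightarrow> 'a option \<Rightarrow> 'a option \<Rightarrow>
  ('q \<times> ('a symbol \<times> move) list \<times> bool \<times> bool \<times> 'a option) option"
type_synonym ('q, 'a) sconfig = "'q \<times> 'a tape list \<times> 'a list \<times> 'a list \<times> 'a list"

fun sstep :: "('q, 'a) sdelta \<Rightarrow> ('q, 'a) sconfig \<Rightarrow> ('q, 'a) sconfig option" where
  "sstep \<delta> (q, ts, p, x, y) =
     (case \<delta> q (map scanned ts) (head p) (head x) of
        None \<Rightarrow> None
      | Some (q', as, c, d, o') \<Rightarrow>
          Some (q', map2 act as ts, consume c p, consume d x, y @ (case o' of None \<Rightarrow> [] | Some l \<Rightarrow> [l])))"

text \<open>Outside \<open>Q\<close> the start state has the zero code, as the blank has outside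
  \<open>S\<close>; an empty state stack thus denotes \<open>q0\<close>.\<close>

locale stream_machine =
  fixes \<delta> :: "('q, 'a::finite) sdelta" and k :: nat and q0 :: 'q and Q :: "'q list" and S :: "'a symbol list"
  assumes q0: "q0 \<notin> set Q" and Blank: "Blank \<notin> set S"
    and closed: "\<And>q rs u v q' as c d o'. \<lbrakk>\<delta> q rs u v = Some (q', as, c, d, o'); q \<in> insert q0 (set Q);
      length rs = k; set rs \<subseteq> insert Blank (set S)\<rbrakk> \<Longrightarrow>
      q' \<in> insert q0 (set Q) \<and> length as = k \<and> fst ` set as \<subseteq> insert Blank (set S)"
begin

text \<open>Stack 0 holds the state, the next \<open>k\<close> stacks the left and the last \<open>k\<close> the right halves of the tapes.\<close>

definition pushes :: "('a symbol \<times> move) list \<Rightarrow> 'a symbol list \<Rightarrow> 'a symbol list list" where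
  "pushes as ls = map fst (map2 push as ls) @ map snd (map2 push as ls)"

text \<open>A rule has to know the cell to the left of each head besides the scanned one, because
  \<open>push\<close> may carry that cell over to the other half.\<close>

definition rule :: "'q \<times> 'a symbol list \<times> 'a option \<times> 'a option \<Rightarrow> 'a rule" where
  "rule = (\<lambda>(q, tops, u, v). case the (\<delta> q (drop k tops) u v) of (q', as, c, d, o') \<Rightarrow>
     (Look u v # concat (map edit_stack ((bits Q q, bits Q q') #
        map2 (\<lambda>s n. (bits S s, enc S n)) tops (pushes as (take k tops)))), c, d, o'))"

text \<open>Combinations without a transition yield no rule, so that halting becomes the absence of
  a fitting rule.\<close>

definition keys :: "('q \<times> 'a symbol list \<times> 'a option \<times> 'a option) set" where
  "keys = {(q, tops, u, v). q \<in> insert q0 (set Q) \<and> set tops \<subseteq> insert Blank (set S) \<and>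
     length tops = 2 * k \<and> \<delta> q (drop k tops) u v \<noteq> None}"

lemma finite_keys: "finite keys"
proof -
  have "finite {tops. set tops \<subseteq> insert Blank (set S) \<and> length tops = 2 * k}"
    by (rule finite_lists_length_eq) simp
  then have "finite (insert q0 (set Q) \<times> {tops. set tops \<subseteq> insert Blank (set S) \<and> length tops = 2 * k} \<times>
      (UNIV :: 'a option set) \<times> (UNIV :: 'a option set))"
    by (intro finite_cartesian_product) simp_all
  then show ?thesis by (rule rev_finite_subset) (auto simp: keys_def)
qed

definition rules :: "'a rule list" where
  "rules = map rule (SOME ks. set ks = keys)"

text \<open>\<open>qs\<close> has at most one entry: it is empty at the start, where
  \<open>q0\<close> is read below the bottom, and \<open>[q]\<close> after every step.\<close>

fun srel :: "('q, 'a) sconfig \<Rightarrow> 'a rconfig \<Rightarrow> bool" where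
  "srel (q, ts, C) (w, C') \<longleftrightarrow> C = C' \<and> q \<in> insert q0 (set Q) \<and> length ts = k \<and>
     (\<exists>qs Ls Rs. length Ls = k \<and> length Rs = k \<and> (\<forall>i<k. tape_rep (ts ! i) (Ls ! i, Rs ! i)) \<and>
        (\<forall>xs\<in>set (Ls @ Rs). set xs \<subseteq> insert Blank (set S)) \<and>
        hd_or q0 qs = q \<and> set qs \<subseteq> {q} \<and> tl qs = [] \<and>
        stacks w (enc Q qs # map (enc S) (Ls @ Rs)))"

lemma srel_step:
  assumes "srel (q, ts, p, x, y) (w, p, x, y)"
  shows "case sstep \<delta> (q, ts, p, x, y) of
      None \<Rightarrow> rstep rules (w, p, x, y) = None
    | Some D \<Rightarrow> \<exists>D'. rstep rules (w, p, x, y) = Some D' \<and> srel D D'"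
proof -
  have q: "q \<in> insert q0 (set Q)" and ts: "length ts = k" using assms by auto
  obtain qs Ls Rs where len: "length Ls = k" "length Rs = k"
    and rep: "\<And>i. i < k \<Longrightarrow> tape_rep (ts ! i) (Ls ! i, Rs ! i)"
    and S: "\<forall>xs\<in>set (Ls @ Rs). set xs \<subseteq> insert Blank (set S)"
    and qs: "hd_or q0 qs = q" "set qs \<subseteq> {q}" "tl qs = []"
    and w: "stacks w (enc Q qs # map (enc S) (Ls @ Rs))"
    using assms unfolding srel.simps by blast
  define tops where "tops = map (hd_or Blank) (Ls @ Rs)"
  have tops: "length tops = 2 * k" "take k tops = map (hd_or Blank) Ls" "drop k tops = map (hd_or Blank) Rs"
    using len by (simp_all add: tops_def)
  have hd_S: "hd_or Blank xs \<in> insert Blank (set S)" if "set xs \<subseteq> insert Blank (set S)" for xs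
    using that by (cases xs) auto
  have topsS: "set tops \<subseteq> insert Blank (set S)"
    unfolding tops_def set_map by (rule image_subsetI, rule hd_S) (rule bspec[OF S])
  have scanned: "map scanned ts = drop k tops"
    unfolding tops using ts len tape_rep_scanned[OF rep] by (simp add: list_eq_iff_nth_eq)
  let ?k0 = "(q, tops, head p, head x)"
  have keys: "?k0 \<in> keys \<longleftrightarrow> \<delta> q (drop k tops) (head p) (head x) \<noteq> None"
    using q topsS tops(1) by (simp add: keys_def)
  obtain ks where ks: "set ks = keys" "rules = map rule ks"
    using someI_ex[OF finite_list[OF finite_keys]] unfolding rules_def by blast
  \<comment> \<open>The core of the proof: a script succeeds exactly when its key describes the
    current configuration. \<open>Look\<close> tests the input letters, the matches test the state
    and all stack tops.\<close>
  have exec: "exec (head p) (head x) (fst (rule (r, tops', u, v))) w =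
      (if (r, tops', u, v) = ?k0
       then Some (flat (enc Q [q'] # map (enc S) (map2 (\<lambda>n xs. n @ tl xs) (pushes as (take k tops)) (Ls @ Rs))))
       else None)"
    if key: "(r, tops', u, v) \<in> keys" and d: "\<delta> r (drop k tops') u v = Some (q', as, c, d, o')"
    for r tops' u v q' as c d o'
  proof (cases "u = head p \<and> v = head x")
    case False
    then show ?thesis using d by (auto simp: rule_def)
  next
    case True
    have r: "r \<in> insert q0 (set Q)" "set tops' \<subseteq> insert Blank (set S)" "length tops' = 2 * k"
      using key by (auto simp: keys_def)
    have "length as = k"
      using closed[OF d r(1)] r(2,3) by (auto dest: in_set_dropD)
    then have len': "length (pushes as (take k tops')) = 2 * k"
      using r(3) by (simp add: pushes_def)
    have e: "edit_stacks (map2 (\<lambda>s n. (bits S s, enc S n)) tops' (pushes as (take k tops'))) (map (enc S) (Ls @ Rs)) =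
      (if tops' = map (hd_or Blank) (Ls @ Rs)
       then Some (map (enc S) (map2 (\<lambda>n xs. n @ tl xs) (pushes as (take k tops')) (Ls @ Rs))) else None)"
      by (rule edit_stacks_enc) (use len len' r S Blank in auto)
    \<comment> \<open>\<open>q0\<close> takes the role of the blank on the state stack.\<close>
    have m: "match (bits Q r) (enc Q qs) = (if r = hd_or q0 qs then Some (enc Q (tl qs)) else None)"
      by (rule match_enc) (use r q qs q0 in auto)
    have "exec (head p) (head x) (fst (rule (r, tops', u, v))) w =
      map_option flat (edit_stacks ((bits Q r, bits Q q') #
        map2 (\<lambda>s n. (bits S s, enc S n)) tops' (pushes as (take k tops'))) (enc Q qs # map (enc S) (Ls @ Rs)))"
      using True d exec_edit_stacks[OF w, of "(bits Q r, bits Q q') #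
        map2 (\<lambda>s n. (bits S s, enc S n)) tops' (pushes as (take k tops'))"] len len' r(3)
      by (simp add: rule_def)
    also have "\<dots> = (if (r, tops', u, v) = ?k0
       then Some (flat (enc Q [q'] # map (enc S) (map2 (\<lambda>n xs. n @ tl xs) (pushes as (take k tops)) (Ls @ Rs))))
       else None)"
      using True e[folded tops_def] m
      by (cases "tops' = tops"; cases "r = q") (simp_all add: qs enc_simps del: map_append)
    finally show ?thesis .
  qed
  have none: "exec (head p) (head x) (fst (rule key)) w = None" if h: "key \<in> set ks" "key \<noteq> ?k0" for key
  proof -
    obtain r tops' u v where key: "key = (r, tops', u, v)" by (cases key)
    obtain q' as c d o' where "\<delta> r (drop k tops') u v = Some (q', as, c, d, o')"
      using h(1) by (auto simp: ks key keys_def)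
    from exec[OF _ this] h show ?thesis by (simp add: ks key)
  qed
  show ?thesis
  proof (cases "\<delta> q (drop k tops) (head p) (head x)")
    case None
    then have "?k0 \<notin> set ks" using keys ks(1) by simp
    \<comment> \<open>As \<open>?k0\<close> is no key, the values given for its rule are
      dummies.\<close>
    then have "rstep rules (w, p, x, y) = None"
      using rstep_map_keys[where f = rule and ks = ks and ?k0.0 = ?k0 and w = w and p = p and x = x and y = y and es = "[]" and c = False and d = False and o' = None and w' = "[]", OF none] by (simp add: ks(2))
    then show ?thesis using None by (simp add: scanned)
  next
    case (Some D)
    obtain q' as c d o' where "D = (q', as, c, d, o')" by (cases D)
    with Some have d: "\<delta> q (drop k tops) (head p) (head x) = Some (q', as, c, d, o')" by simp
    have cl: "q' \<in> insert q0 (set Q)" "length as = k" "fst ` set as \<subseteq> insert Blank (set S)"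
      using closed[OF d q] topsS tops(1) by (auto dest: in_set_dropD)
    define Ls' where "Ls' = map2 (\<lambda>n xs. n @ tl xs) (map fst (map2 push as (take k tops))) Ls"
    define Rs' where "Rs' = map2 (\<lambda>n xs. n @ tl xs) (map snd (map2 push as (take k tops))) Rs"
    have new: "map2 (\<lambda>n xs. n @ tl xs) (pushes as (take k tops)) (Ls @ Rs) = Ls' @ Rs'"
      using len cl(2) tops by (simp add: pushes_def Ls'_def Rs'_def zip_append)
    have key: "?k0 \<in> set ks" using keys ks(1) d by simp
    let ?w' = "flat (enc Q [q'] # map (enc S) (Ls' @ Rs'))"
    obtain es where es: "rule ?k0 = (es, c, d, o')" using d by (simp add: rule_def)
    have "exec (head p) (head x) es w = Some ?w'"
      using exec[OF _ d] key unfolding ks es new by simp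
    then have r: "rstep rules (w, p, x, y) =
        Some (?w', consume c p, consume d x, y @ (case o' of None \<Rightarrow> [] | Some l \<Rightarrow> [l]))"
      using rstep_map_keys[where f = rule and ks = ks and ?k0.0 = ?k0 and w = w and p = p and x = x and y = y and es = es and c = c and d = d and o' = o' and w' = ?w', OF none] key es by (simp add: ks(2))
    have nth: "Ls' ! i = fst (push (as ! i) (hd_or Blank (Ls ! i))) @ tl (Ls ! i)"
      "Rs' ! i = snd (push (as ! i) (hd_or Blank (Ls ! i))) @ tl (Rs ! i)" if "i < k" for i
      using that len cl(2) tops by (simp_all add: Ls'_def Rs'_def)
    have len': "length Ls' = k" "length Rs' = k"
      using len cl(2) tops by (simp_all add: Ls'_def Rs'_def)
    have "tape_rep (map2 act as ts ! i) (Ls' ! i, Rs' ! i)" if "i < k" for i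
      using tape_rep_act[OF rep[OF that], of "as ! i"] that ts cl(2) by (simp add: nth del: tape_rep.simps)
    moreover have push_set: "set (fst (push a l)) \<union> set (snd (push a l)) \<subseteq> {fst a, l}" for a :: "'a symbol \<times> move" and l
      by (cases "(a, l)" rule: push.cases) auto
    have "set (Ls' ! i) \<union> set (Rs' ! i) \<subseteq> insert Blank (set S)" if "i < k" for i
    proof -
      have lr: "set (Ls ! i) \<subseteq> insert Blank (set S)" "set (Rs ! i) \<subseteq> insert Blank (set S)"
        using that len S by auto
      have "fst (as ! i) \<in> insert Blank (set S)"
        by (rule subsetD[OF cl(3)]) (use that cl(2) in auto)
      moreover note hd_S[OF lr(1)]
      ultimately
      have "set (fst (push (as ! i) (hd_or Blank (Ls ! i)))) \<union> set (snd (push (as ! i) (hd_or Blank (Ls ! i)))) \<subseteq> insert Blank (set S)"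
        using push_set[of "as ! i" "hd_or Blank (Ls ! i)"] by auto
      moreover have "set (tl (Ls ! i)) \<subseteq> insert Blank (set S)" "set (tl (Rs ! i)) \<subseteq> insert Blank (set S)"
        using lr by (cases "Ls ! i"; cases "Rs ! i"; simp)+
      ultimately show ?thesis unfolding nth[OF that] by auto
    qed
    then have "set xs \<subseteq> insert Blank (set S)" if h: "xs \<in> set (Ls' @ Rs')" for xs
    proof -
      obtain i where "i < k" "xs = Ls' ! i \<or> xs = Rs' ! i"
        using h len' by (auto simp: in_set_conv_nth)
      then show ?thesis
        using \<open>\<And>i. i < k \<Longrightarrow> set (Ls' ! i) \<union> set (Rs' ! i) \<subseteq> insert Blank (set S)\<close>[of i] by (elim disjE) simp_all
    qed
    ultimately have "srel (q', map2 act as ts, consume c p, consume d x, y @ (case o' of None \<Rightarrow> [] | Some l \<Rightarrow> [l]))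
       (?w', consume c p, consume d x, y @ (case o' of None \<Rightarrow> [] | Some l \<Rightarrow> [l]))"
      using cl(1,2) ts len' stacks_flat[of "enc Q [q'] # map (enc S) (Ls' @ Rs')"]
      unfolding srel.simps
      by (intro conjI exI[of _ "[q']"] exI[of _ Ls'] exI[of _ Rs'] ballI allI impI) simp_all
    then show ?thesis using r d by (simp add: scanned del: srel.simps)
  qed
qed

lemma sstep_rules:
  "(\<exists>D. halts_at (sstep \<delta>) (q0, replicate k (word_tape []), p, x, []) D \<and> snd (snd (snd (snd D))) = y) \<longleftrightarrow>
    (\<exists>C. halts_at (rstep rules) ([], p, x, []) C \<and> snd (snd (snd C)) = y)"
proof (rule simulation[where rel = srel])
  have "tape_rep (word_tape []) ([], [])"
    using tape_rep_word_tape[of "[]"] by simp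
  moreover have "stacks [] (enc Q [] # map (enc S) (replicate k [] @ replicate k []))"
    using stacks_Nil[of "1 + (k + k)"] by (simp add: enc_simps replicate_add)
  ultimately show "srel (q0, replicate k (word_tape []), p, x, []) ([], p, x, [])"
    unfolding srel.simps
    by (intro conjI exI[of _ "[]"] exI[of _ "replicate k []"]) auto
next
  fix D C D'
  assume rel: "srel D C" and step: "sstep \<delta> D = Some D'"
  obtain q ts p x y where D: "D = (q, ts, p, x, y)" by (cases D)
  obtain w where C: "C = (w, p, x, y)" using rel by (cases C) (auto simp: D)
  from srel_step[OF rel[unfolded C D]] step obtain C' where "rstep rules C = Some C'" "srel D' C'"
    unfolding C D by (auto simp del: srel.simps sstep.simps)
  then show "\<exists>C'. steps1 (rstep rules) C C' \<and> srel D' C'" by blast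
next
  fix D C
  assume rel: "srel D C" and step: "sstep \<delta> D = None"
  obtain q ts p x y where D: "D = (q, ts, p, x, y)" by (cases D)
  obtain w where C: "C = (w, p, x, y)" using rel by (cases C) (auto simp: D)
  from srel_step[OF rel[unfolded C D]] step have "rstep rules C = None"
    unfolding C D by (simp del: srel.simps sstep.simps)
  then show "\<exists>C'. halts_at (rstep rules) C C' \<and> (\<forall>y. snd (snd (snd (snd D))) = y \<longleftrightarrow> snd (snd (snd C')) = y)"
    by (intro exI[of _ C]) (simp add: halts_at_def C D)
qed

end

section \<open>Turing machines as machines with streams\<close>

text \<open>The boolean selects the input, \<open>False\<close> for \<open>p\<close> and
  \<open>True\<close> for \<open>x\<close>, so that \<open>of_bool i\<close> is the number of the
  tape it is copied to.\<close>

datatype control = Read bool | Back bool | Sim nat | Write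

text \<open>The run of \<open>T\<close> is enclosed between copying the two streams to tapes 0 and
  1, with the heads returned to cell 0, and sending the word on tape 2 to the output stream.\<close>

fun tdelta :: "'a tm \<Rightarrow> (control, 'a) sdelta" where
  "tdelta T (Read i) rs u v =
     (case if i then v else u of
        Some l \<Rightarrow> Some (Read i, (stay rs)[of_bool i := (Letter l, MoveRight)], \<not> i, i, None)
      | None \<Rightarrow> Some (Back i, (stay rs)[of_bool i := (rs ! of_bool i, MoveLeft)], False, False, None))"
| "tdelta T (Back i) rs u v =
     Some (if rs ! of_bool i = Blank
       then (if i then Sim (start T) else Read True, (stay rs)[of_bool i := (rs ! of_bool i, MoveRight)], False, False, None)
       else (Back i, (stay rs)[of_bool i := (rs ! of_bool i, MoveLeft)], False, False, None))"
| "tdelta T (Sim q) rs u v =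
     (case delta T q rs of
        Some (q', as) \<Rightarrow> Some (Sim q', as, False, False, None)
      | None \<Rightarrow> Some (Write, stay rs, False, False, None))"
| "tdelta T Write rs u v =
     (case rs ! 2 of
        Letter l \<Rightarrow> Some (Write, (stay rs)[2 := (Letter l, MoveRight)], False, False, Some l)
      | _ \<Rightarrow> None)"

definition controls :: "'a tm \<Rightarrow> control set" where
  "controls T = {Read False, Read True, Back False, Back True, Write} \<union> Sim ` states T"

lemma tdelta_closed:
  assumes T: "turing_machine T" and d: "tdelta T q rs u v = Some (q', as, c, d, o')"
    and q: "q \<in> controls T" and rs: "length rs = tapes T" "set rs \<subseteq> symbols T"
  shows "q' \<in> controls T \<and> valid_acts (tapes T) (symbols T) as"
proof -
  have k: "3 \<le> tapes T" and S: "start T \<in> states T" "Blank \<in> symbols T" "range Letter \<subseteq> symbols T"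
    using T by (auto simp: turing_machine_def)
  have Letter: "Letter l \<in> symbols T" for l using S(3) by auto
  have nth: "rs ! j \<in> symbols T" if "j < 3" for j
    by (rule subsetD[OF rs(2)], rule nth_mem) (use k rs(1) that in simp)
  then have i: "rs ! of_bool i \<in> symbols T" "rs ! 0 \<in> symbols T" "rs ! Suc 0 \<in> symbols T" for i
    by simp_all
  note valid = valid_acts_stay[OF rs] valid_acts_update Letter i
  show ?thesis
  proof (cases q)
    case (Read i)
    then show ?thesis using d by (cases i) (auto simp: controls_def valid split: option.splits)
  next
    case (Back i)
    have "valid_acts (tapes T) (symbols T) ((stay rs)[of_bool i := (rs ! of_bool i, m)])" for m
      by (simp add: valid)
    then show ?thesis using d S(1) Back by (auto simp: controls_def split: if_splits)
  next
    case (Sim r)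
    then have r: "r \<in> states T" using q by (auto simp: controls_def)
    show ?thesis
    proof (cases "delta T r rs")
      case None
      then show ?thesis using d Sim by (auto simp: controls_def valid)
    next
      case (Some ra)
      then obtain r' as' where ra: "delta T r rs = Some (r', as')" by (cases ra) simp
      then have "r' \<in> states T" "valid_acts (tapes T) (symbols T) as'"
        using T r rs unfolding turing_machine_def valid_acts_def by blast+
      then show ?thesis using d Sim ra by (auto simp: controls_def)
    qed
  next
    case Write
    then show ?thesis using d by (auto simp: controls_def valid split: symbol.splits)
  qed
qed

lemma ex_stream_machine:
  assumes "turing_machine (T :: 'a::finite tm)"
  shows "\<exists>Q S. stream_machine (tdelta T) (tapes T) (Read False) Q S"
proof -
  have fin: "finite (controls T - {Read False})" "finite (symbols T - {Blank})"
    and Blank: "Blank \<in> symbols T"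
    using assms by (auto simp: turing_machine_def controls_def)
  obtain Q where Q: "set Q = controls T - {Read False}" using finite_list[OF fin(1)] by blast
  obtain S where S: "set S = symbols T - {Blank}" using finite_list[OF fin(2)] by blast
  have "insert (Read False) (set Q) = controls T" "insert Blank (set S) = symbols T"
    using Q S Blank by (auto simp: controls_def)
  then have "stream_machine (tdelta T) (tapes T) (Read False) Q S"
    using tdelta_closed[OF assms] Q S by unfold_locales (auto simp: valid_acts_def)
  then show ?thesis by blast
qed

section \<open>Reading the inputs and writing the output\<close>

lemma act_stay: "map2 act (stay (map scanned ts)) ts = ts"
proof -
  have "act (scanned t, Stay) t = t" for t :: "'a tape" by (cases t) simp
  then show ?thesis by (simp add: stay_def list_eq_iff_nth_eq)
qed

lemma act_stay_update:
  assumes "i < length ts"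
  shows "map2 act ((stay (map scanned ts))[i := a]) ts = ts[i := act a (ts ! i)]"
proof -
  have "act (scanned t, Stay) t = t" for t :: "'a tape" by (cases t) simp
  then show ?thesis using assms by (simp add: stay_def list_eq_iff_nth_eq nth_list_update)
qed

lemma act_scanned_move:
  "act (scanned t, MoveLeft) t = (fst t, snd t - 1)" "act (scanned t, MoveRight) t = (fst t, snd t + 1)"
  by (cases t; simp)+

lemma word_tape_snoc: "(fst (word_tape w))(int (length w) := Letter l) = fst (word_tape (w @ [l]))"
proof
  fix i :: int
  consider "i < 0" | "0 \<le> i" "i < int (length w)" | "i = int (length w)" | "i > int (length w)" by linarith
  then show "((fst (word_tape w))(int (length w) := Letter l)) i = fst (word_tape (w @ [l])) i"
    by cases (auto simp: word_tape_def nth_append nat_less_iff)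
qed

lemma read_input:
  assumes "of_bool i < length ts" "u = (if i then x else p)"
  shows "steps (sstep (tdelta T)) (Read i, ts[of_bool i := (fst (word_tape w), int (length w))], p, x, y)
    (Back i, ts[of_bool i := (fst (word_tape (w @ u)), int (length (w @ u)) - 1)],
      if i then p else [], if i then [] else x, y)"
  using assms(2)
proof (induction u arbitrary: w p x)
  case Nil
  then show ?case using assms(1)
    by (intro r_into_rtranclp)
      (cases i; simp add: act_stay_update act_scanned_move consume_def del: act.simps scanned.simps)
next
  case (Cons l u)
  let ?p = "if i then p else tl p" and ?x = "if i then tl x else x"
  have "sstep (tdelta T) (Read i, ts[of_bool i := (fst (word_tape w), int (length w))], p, x, y) =
    Some (Read i, ts[of_bool i := (fst (word_tape (w @ [l])), int (length (w @ [l])))], ?p, ?x, y)"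
    using assms(1) Cons.prems
    by (cases i; cases p; cases x) (auto simp: act_stay_update consume_def word_tape_snoc[symmetric] add.commute)
  moreover have "u = (if i then ?x else ?p)" using Cons.prems by (cases i; cases p; cases x) auto
  note Cons.IH[OF this, of "w @ [l]"]
  ultimately show ?case by (simp add: steps_step cong: if_cong)
qed

lemma back_input:
  assumes "of_bool i < length ts" "n \<le> length w"
  shows "steps (sstep (tdelta T)) (Back i, ts[of_bool i := (fst (word_tape w), int n - 1)], p, x, y)
    (if i then Sim (start T) else Read True, ts[of_bool i := word_tape w], p, x, y)"
  using assms(2)
proof (induction n)
  case 0
  show ?case using assms(1)
    by (intro r_into_rtranclp)
      (simp add: act_stay_update consume_def word_tape_def fun_upd_idem)
next
  case (Suc n)
  have "sstep (tdelta T) (Back i, ts[of_bool i := (fst (word_tape w), int (Suc n) - 1)], p, x, y) =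
    Some (Back i, ts[of_bool i := (fst (word_tape w), int n - 1)], p, x, y)"
    using assms(1) Suc.prems by (simp add: act_stay_update consume_def word_tape_def fun_upd_idem)
  moreover note Suc.IH
  ultimately show ?case using Suc.prems by (simp add: steps_step)
qed

lemma read_inputs:
  assumes "3 \<le> tapes T"
  shows "steps (sstep (tdelta T)) (Read False, replicate (tapes T) (word_tape []), p, x, [])
    (Sim (start T), snd (initial T p x), [], [], [])"
proof -
  define k where "k = tapes T - 2"
  then have k: "tapes T = Suc (Suc k)" using assms by simp
  let ?b = "replicate k (word_tape [] :: 'a tape)"
  have b: "(fst (word_tape []), 0) = word_tape []" by (simp add: word_tape_def)
  have 1: "steps (sstep (tdelta T)) (Read False, word_tape [] # word_tape [] # ?b, p, x, [])
      (Back False, (fst (word_tape p), int (length p) - 1) # word_tape [] # ?b, [], x, [])"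
    using read_input[of False "word_tape [] # word_tape [] # ?b" p x p T "[]" "[]"] by (simp add: b)
  have 2: "steps (sstep (tdelta T)) (Back False, (fst (word_tape p), int (length p) - 1) # word_tape [] # ?b, [], x, [])
      (Read True, word_tape p # word_tape [] # ?b, [], x, [])"
    using back_input[of False "word_tape [] # word_tape [] # ?b" "length p" p T "[]" x "[]"] by simp
  have 3: "steps (sstep (tdelta T)) (Read True, word_tape p # word_tape [] # ?b, [], x, [])
      (Back True, word_tape p # (fst (word_tape x), int (length x) - 1) # ?b, [], [], [])"
    using read_input[of True "word_tape p # word_tape [] # ?b" x x "[]" T "[]" "[]"] by (simp add: b)
  have 4: "steps (sstep (tdelta T)) (Back True, word_tape p # (fst (word_tape x), int (length x) - 1) # ?b, [], [], [])
      (Sim (start T), word_tape p # word_tape x # ?b, [], [], [])"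
    using back_input[of True "word_tape p # word_tape [] # ?b" "length x" x T "[]" "[]" "[]"] by simp
  show ?thesis
    using rtranclp_trans[OF 1 rtranclp_trans[OF 2 rtranclp_trans[OF 3 4]]]
    by (simp add: k initial_def)
qed

lemma write_output:
  assumes "reads_word (ts ! 2) w" "2 < length ts"
  shows "\<exists>ts'. halts_at (sstep (tdelta T)) (Write, ts, [], [], y) (Write, ts', [], [], y @ w)"
  using assms
proof (induction w arbitrary: ts y)
  case Nil
  obtain t h where t: "ts ! 2 = (t, h)" by (cases "ts ! 2")
  have "sstep (tdelta T) (Write, ts, [], [], y) = None"
    using Nil by (auto simp: t split: symbol.splits)
  then show ?case by (auto simp: halts_at_def)
next
  case (Cons l w)
  obtain t h where t: "ts ! 2 = (t, h)" by (cases "ts ! 2")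
  have r: "t (h + int i) = Letter ((l # w) ! i)" if "i < length (l # w)" for i
    using Cons.prems(1) that unfolding t by simp
  have l: "t h = Letter l" using r[of 0] by simp
  have "t (h + 1 + int i) = Letter (w ! i)" if "i < length w" for i
    using r[of "Suc i"] that by (simp add: algebra_simps)
  moreover have "t (h + 1 + int (length w)) \<notin> range Letter"
    using Cons.prems(1) unfolding t by (simp add: algebra_simps)
  ultimately have "reads_word (ts[2 := (t, h + 1)] ! 2) w" using Cons.prems(2) by simp
  from Cons.IH[OF this, of "y @ [l]"] Cons.prems(2)
  obtain ts' where "halts_at (sstep (tdelta T)) (Write, ts[2 := (t, h + 1)], [], [], y @ [l]) (Write, ts', [], [], y @ l # w)"
    by auto
  moreover have "sstep (tdelta T) (Write, ts, [], [], y) = Some (Write, ts[2 := (t, h + 1)], [], [], y @ [l])"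
    using Cons.prems(2) l by (simp add: t act_stay_update consume_def fun_upd_idem)
  ultimately show ?case
    using halts_at_step[of "sstep (tdelta T)" "(Write, ts, [], [], y)" "(Write, ts[2 := (t, h + 1)], [], [], y @ [l])"
        "(Write, ts', [], [], y @ l # w)"]
    by (intro exI[of _ ts']) (simp only:)
qed

section \<open>Reachable tapes carry finitely many nonblank symbols\<close>

definition finite_tape :: "'a tape \<Rightarrow> bool" where
  "finite_tape t \<longleftrightarrow> finite {i. fst t i \<noteq> Blank}"

text \<open>If letters continued forever to the right of the head, a halting \<open>T\<close> would
  have no result and \<open>Write\<close> would never end, while \<open>simulation\<close> demands
  that halting be answered by halting.\<close>

lemma ex_reads_word:
  assumes "finite_tape t" shows "\<exists>w. reads_word t w"
proof -
  obtain f h where t: "t = (f, h)" by (cases t)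
  have "\<exists>n. f (h + int n) \<notin> range Letter"
  proof (rule ccontr)
    assume "\<nexists>n. f (h + int n) \<notin> range Letter"
    then have "f (h + int n) \<in> range Letter" for n by blast
    then have "f (h + int n) \<noteq> Blank" for n by (metis imageE symbol.distinct(1))
    then have "range (\<lambda>n. h + int n) \<subseteq> {i. fst t i \<noteq> Blank}" by (auto simp: t)
    then have "finite (range (\<lambda>n. h + int n))" using assms finite_subset unfolding finite_tape_def by blast
    moreover have "inj (\<lambda>n. h + int n)" by (rule injI) simp
    ultimately show False using finite_imageD by blast
  qed
  then obtain n where n: "f (h + int n) \<notin> range Letter" "\<And>i. i < n \<Longrightarrow> f (h + int i) \<in> range Letter"
    using exists_least_iff[of "\<lambda>n. f (h + int n) \<notin> range Letter"] by blast
  have "f (h + int i) = Letter (SOME l. f (h + int i) = Letter l)" if "i < n" for i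
    by (rule someI_ex) (use n(2)[OF that] in auto)
  then have "reads_word t (map (\<lambda>i. SOME l. f (h + int i) = Letter l) [0..<n])"
    using n(1) by (simp add: t)
  then show ?thesis by blast
qed

text \<open>\<open>turing_machine\<close> restricts \<open>delta\<close> only on its finite domain,
  so it must be known that a run never leaves this domain.\<close>

definition tinv :: "'a tm \<Rightarrow> 'a config \<Rightarrow> bool" where
  "tinv T c \<longleftrightarrow> fst c \<in> states T \<and> length (snd c) = tapes T \<and>
     (\<forall>t \<in> set (snd c). range (fst t) \<subseteq> symbols T \<and> finite_tape t)"

lemma tinv_initial: "turing_machine T \<Longrightarrow> tinv T (initial T p x)"
proof -
  assume T: "turing_machine T"
  have "finite_tape (word_tape w)" for w :: "'a list"
    unfolding finite_tape_def by (rule finite_subset[of _ "{0..<int (length w)}"]) (auto simp: word_tape_def)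
  moreover have "range (fst (word_tape w)) \<subseteq> symbols T" for w
    using T by (auto simp: word_tape_def turing_machine_def)
  ultimately show ?thesis using T by (auto simp: tinv_def initial_def turing_machine_def)
qed

lemma tinv_step:
  assumes T: "turing_machine T" and inv: "tinv T c" and step: "step T c = Some d"
  shows "tinv T d"
proof -
  obtain q ts where c: "c = (q, ts)" by (cases c)
  obtain q' as where d: "delta T q (map scanned ts) = Some (q', as)" "d = (q', map2 act as ts)"
    using step by (auto simp: c split: option.splits)
  have scanned: "scanned t \<in> symbols T" if "t \<in> set ts" for t
  proof -
    have "range (fst t) \<subseteq> symbols T" using inv that by (simp add: tinv_def c)
    then show ?thesis by (cases t) auto
  qed
  have "q \<in> states T" "length (map scanned ts) = tapes T" "set (map scanned ts) \<subseteq> symbols T"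
    using inv scanned by (auto simp: tinv_def c simp del: scanned.simps)
  with T d(1) have as: "q' \<in> states T" "length as = tapes T" "fst ` set as \<subseteq> symbols T"
    unfolding turing_machine_def by blast+
  have new: "range (fst (act a t)) \<subseteq> symbols T \<and> finite_tape (act a t)" if "a \<in> set as" "t \<in> set ts" for a t
  proof -
    obtain s m where a: "a = (s, m)" by (cases a)
    obtain f h where t: "t = (f, h)" by (cases t)
    have "range (fst t) \<subseteq> symbols T \<and> finite_tape t" using inv that(2) by (simp add: tinv_def c)
    then have f: "range f \<subseteq> symbols T" "finite {i. f i \<noteq> Blank}" by (simp_all add: t finite_tape_def)
    have s: "s \<in> symbols T" using as(3) that(1) by (force simp: a)
    have "{i. (f(h := s)) i \<noteq> Blank} \<subseteq> insert h {i. f i \<noteq> Blank}" by auto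
    then have "finite {i. (f(h := s)) i \<noteq> Blank}" using f(2) by (meson finite_insert finite_subset)
    then show ?thesis using f(1) s by (auto simp: a t finite_tape_def)
  qed
  have "range (fst t) \<subseteq> symbols T \<and> finite_tape t" if h: "t \<in> set (map2 act as ts)" for t
  proof -
    obtain a t0 where a: "(a, t0) \<in> set (zip as ts)" and t: "t = act a t0" using h by auto
    show ?thesis unfolding t by (rule new[OF set_zip_leftD[OF a] set_zip_rightD[OF a]])
  qed
  then show ?thesis using as(1,2) inv by (simp add: tinv_def d(2) c)
qed

lemma yields_tdelta:
  assumes T: "turing_machine T"
  shows "yields T p x w \<longleftrightarrow>
    (\<exists>D. halts_at (sstep (tdelta T)) (Read False, replicate (tapes T) (word_tape []), p, x, []) D \<and>
      snd (snd (snd (snd D))) = w)"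
proof -
  have k: "3 \<le> tapes T" using T by (simp add: turing_machine_def)
  have "(\<exists>c. halts_at (step T) (initial T p x) c \<and> reads_word (snd c ! 2) w) \<longleftrightarrow>
    (\<exists>D. halts_at (sstep (tdelta T)) (Sim (start T), snd (initial T p x), [], [], []) D \<and>
      snd (snd (snd (snd D))) = w)"
  proof (rule simulation[where rel = "\<lambda>c D. tinv T c \<and> D = (Sim (fst c), snd c, [], [], [])"])
    show "tinv T (initial T p x) \<and> (Sim (start T), snd (initial T p x), [], [], []) =
        (Sim (fst (initial T p x)), snd (initial T p x), [], [], [])"
      using tinv_initial[OF T] by (simp add: initial_def)
  next
    fix c d and D :: "(control, 'a) sconfig"
    assume rel: "tinv T c \<and> D = (Sim (fst c), snd c, [], [], [])" and step: "step T c = Some d"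
    have "sstep (tdelta T) D = Some (Sim (fst d), snd d, [], [], [])"
      using rel step by (cases c) (auto simp: consume_def split: option.splits)
    then show "\<exists>D'. steps1 (sstep (tdelta T)) D D' \<and> tinv T d \<and> D' = (Sim (fst d), snd d, [], [], [])"
      using tinv_step[OF T _ step] rel by blast
  next
    fix c and D :: "(control, 'a) sconfig"
    assume rel: "tinv T c \<and> D = (Sim (fst c), snd c, [], [], [])" and step: "step T c = None"
    have 2: "2 < length (snd c)" using rel k by (simp add: tinv_def)
    then have "finite_tape (snd c ! 2)" using rel by (simp add: tinv_def)
    then obtain v where v: "reads_word (snd c ! 2) v" using ex_reads_word by blast
    obtain ts' where ts': "halts_at (sstep (tdelta T)) (Write, snd c, [], [], []) (Write, ts', [], [], v)"
      using write_output[OF v 2, of T "[]"] by auto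
    have "sstep (tdelta T) D = Some (Write, snd c, [], [], [])"
      using rel step by (cases c) (auto simp: consume_def act_stay split: option.splits)
    then have "halts_at (sstep (tdelta T)) D (Write, ts', [], [], v)"
      using ts' halts_at_step[of "sstep (tdelta T)" D "(Write, snd c, [], [], [])"] by blast
    moreover have "\<forall>w. reads_word (snd c ! 2) w \<longleftrightarrow> v = w" using v reads_word_unique by blast
    ultimately show "\<exists>D'. halts_at (sstep (tdelta T)) D D' \<and>
        (\<forall>w. reads_word (snd c ! 2) w \<longleftrightarrow> snd (snd (snd (snd D'))) = w)"
      by (intro exI[of _ "(Write, ts', [], [], v)"]) simp
  qed
  then show ?thesis
    unfolding yields_iff_halts_at halts_at_steps[OF read_inputs[OF k]] .
qed

section \<open>Optimality\<close>

lemma (in universal) universal: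
  assumes "turing_machine T"
  shows "\<exists>c. \<forall>p x. result U (c @ p) x = result T p x"
proof -
  obtain Q S where "stream_machine (tdelta T) (tapes T) (Read False) Q S"
    using ex_stream_machine[OF assms] by blast
  then interpret stream_machine "tdelta T" "tapes T" "Read False" Q S .
  \<comment> \<open>The three translations composed. The rules depend on \<open>T\<close> alone, so
    one code serves all \<open>p\<close> and \<open>x\<close>.\<close>
  have "yields U (rcode a b rules @ p) x w \<longleftrightarrow> yields T p x w" for p x w
    using yields_utm[of rules p x w] yields_tdelta[OF assms, of p x w] sstep_rules[of p x w] by simp
  then have "yields U (rcode a b rules @ p) x = yields T p x" for p x by (intro ext)
  then have "result U (rcode a b rules @ p) x = result T p x" for p x by (simp add: result_def)
  then show ?thesis by blast
qed

text \<open>Prefixing \<open>c\<close> preserves the computed partial function, hence solutions for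
  every predicate at once: the constant does not vary with \<open>P\<close>.\<close>

lemma problem_complexity_le:
  assumes "\<And>p x. result M (c @ p) x = result T p x"
  shows "problem_complexity P M \<le> problem_complexity P T + enat (length c)"
proof (cases "\<exists>p. solves P T p")
  case True
  then obtain p where p: "solves P T p" "problem_complexity P T = enat (length p)"
    using problem_complexity_attained by blast
  then have "solves P M (c @ p)" by (simp add: solves_def assms)
  then have "problem_complexity P M \<le> enat (length (c @ p))"
    unfolding problem_complexity_def by (intro Inf_lower) blast
  then show ?thesis by (simp add: p(2) add.commute)
next
  case False
  then show ?thesis using problem_complexity_infinite by fastforce
qed

theorem theorem5p1:
  fixes PP :: "(('a::finite list \<Rightarrow> 'a list option) \<Rightarrow> bool) set"
  assumes "2 \<le> card (UNIV :: 'a set)"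
  shows "\<exists>M :: 'a tm. turing_machine M \<and>
    (\<forall>T :: 'a tm. turing_machine T \<longrightarrow>
      (\<exists>k :: nat. \<forall>P \<in> PP. problem_complexity P M \<le> problem_complexity P T + enat k))"
proof -
  \<comment> \<open>The tally mark and the end mark of the program code.\<close>
  obtain a b :: 'a where ab: "a \<noteq> b"
    using assms card_le_Suc0_iff_eq[of "UNIV :: 'a set"] by auto
  obtain K where K: "code_bound K TYPE('a)" using ex_code_bound by blast
  interpret universal a b K using ab K by unfold_locales
  show ?thesis
  proof (intro exI[of _ U] conjI allI impI)
    show "turing_machine U" by (rule turing_machine_utm[OF K])
  next
    fix T :: "'a tm"
    assume "turing_machine T"
    then obtain c where "\<And>p x. result U (c @ p) x = result T p x" using universal by blast
    from problem_complexity_le[OF this]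
    show "\<exists>k. \<forall>P\<in>PP. problem_complexity P U \<le> problem_complexity P T + enat k" by blast
  qed
qed

end
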